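(* Let $(\mathcal T_\ell)_{\ell\in\mathbb N_0}$ be the sequence of meshes generated by the goal-oriented adaptive algorithm using Marking Strategy A or Marking Strategy B. Suppose that the refinement strategy has the marking property, the child property, uniform size reduction, bounded patches, and comparable patch elements. Suppose further that $X$ and $D$ are each equipped with a family of seminorms that is subadditive, absolutely continuous, and approximates the natural norm. Finally, suppose that local discrete efficiency, boundedness of the oscillation terms, and the natural approximation property hold. Then a priori convergence of $(u_\ell)_{\ell\in\mathbb N_0}$ and $(z_\ell)_{\ell\in\mathbb N_0}$, i.e., existence of $u_\infty,z_\infty\in X$ with $\|u_\infty-u_\ell\|_X\to0$ and $\|z_\infty-z_\ell\|_X\to0$ as $\ell\to\infty$, implies $$\eta_\ell\,\zeta_\ell\to0\qquad\text{as }\ell\to\infty .$$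
   Context: General setting. $\Omega\subset\mathbb R^d$, $d\ge1$, is a bounded Lipschitz domain, $|\cdot|$ is the Lebesgue measure, $|\Omega|>0$, and $X$ is a normed space of functions on $\Omega$. A mesh is a finite set $\mathcal T$ of compact subsets $T\subseteq\overline\Omega$ (elements) with $|T|>0$, $|T\cap T'|=0$ for distinct $T,T'\in\mathcal T$, and $\bigcup\mathcal T=\overline\Omega$. A refinement strategy is a fixed map that assigns to a mesh $\mathcal T_H$ and a set $\mathcal M_H\subseteq\mathcal T_H$ of marked elements a mesh $\mathrm{refine}(\mathcal T_H,\mathcal M_H)$. $\mathbb T(\mathcal T_H)$ denotes the set of all meshes obtained from $\mathcal T_H$ by finitely many refinement steps with arbitrary sets of marked elements; $\mathcal T_0$ is a fixed initial mesh and $\mathbb T:=\mathbb T(\mathcal T_0)$. To every $\mathcal T_H\in\mathbb T$ are associated a discrete subspace $X_H\subset X$, functions $u_H,z_H\in X_H$, and refinement indicators $\eta_H(T),\zeta_H(T)\ge0$ for $T\in\mathcal T_H$. For $\xi\in\{\eta,\zeta\}$ and $\mathcal U_H\subseteq\mathcal T_H$ put $\xi_H(\mathcal U_H):=\big(\sum_{T\in\mathcal U_H}\xi_H(T)^2\big)^{1/2}$ and $\xi_H:=\xi_H(\mathcal T_H)$. Objects belonging to $\mathcal T_h$, $\mathcal T_\ell$ carry the index $h$, $\ell$. Further, $u,z\in X$ are fixed (exact primal and dual solutions), $G:X\to\mathbb R$ is continuous, and there are $G_H\in\mathbb R$ and a constant $C_{\rm go}>0$ with $|G(u)-G_H|\le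 C_{\rm go}\,\eta_H\zeta_H$ for all $\mathcal T_H\in\mathbb T$. Algorithm. Starting from $\mathcal T_0$, for $\ell=0,1,2,\dots$: compute $u_\ell,z_\ell$ and $\eta_\ell(T),\zeta_\ell(T)$; choose $\mathcal M_\ell\subseteq\mathcal T_\ell$ by the marking strategy; set $\mathcal T_{\ell+1}:=\mathrm{refine}(\mathcal T_\ell,\mathcal M_\ell)$. If $\eta_{\ell_0}\zeta_{\ell_0}=0$ for some minimal $\ell_0$, the algorithm stops and one sets $\mathcal T_\ell:=\mathcal T_{\ell_0}$ for $\ell\ge\ell_0$. Marking Strategy A: with a fixed function $V:\mathbb R_{\ge0}^2\to\mathbb R_{\ge0}$ that is continuous at $(0,0)$ with $V(0,0)=0$, choose $\mathcal M_H\subseteq\mathcal T_H$ such that $\big[\max_{T\in\mathcal T_H\setminus\mathcal M_H}\eta_H(T)\big]\big[\max_{T\in\mathcal T_H\setminus\mathcal M_H}\zeta_H(T)\big]\le V(\eta_H(\mathcal M_H),\zeta_H(\mathcal M_H))$ (maximum over the empty set is $0$). Marking Strategy B: with a fixed $\theta\in(0,1]$ and a fixed function $W:\mathbb R_{\ge0}^2\to\mathbb R_{\ge0}$ with $W(1,1)=1$ and $W(x,y)\le C_W\max\{x,y\}$ for all $x,y\in[0,1]$, where $C_W>0$ is a constant, choose $\mathcal M_H\subseteq\mathcal T_H$ such that $0<\theta\le W\big(\eta_H(\mathcal M_H)^2/\eta_H^2,\ \zeta_H(\mathcal M_H)^2/\zeta_H^2\big)$. Patches. For $\mathcal T_H\in\mathbb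 T$ and $\omega\subseteq\overline\Omega$: $\mathcal T_H[\omega]:=\{T\in\mathcal T_H:\overline\omega\cap T\ne\emptyset\}$ and $\Omega_H[\omega]:=\bigcup\mathcal T_H[\omega]$. Properties of the refinement strategy. With constants $0<\rho_{\rm child}<1$ and $C_{\rm patch},C_{\rm size}\ge1$, for all $\mathcal T_H\in\mathbb T$, $\mathcal M_H\subseteq\mathcal T_H$, $\mathcal T_h:=\mathrm{refine}(\mathcal T_H,\mathcal M_H)$: - marking property: $\mathcal M_H\subseteq\mathcal T_H\setminus\mathcal T_h$; - child property: $T=\bigcup\{T'\in\mathcal T_h:T'\subseteq T\}$ for all $T\in\mathcal T_H$; - uniform size reduction: $|T'|<\rho_{\rm child}|T|$ for all $T\in\mathcal T_H\setminus\mathcal T_h$ and $T'\in\mathcal T_h$ with $T'\subseteq T$; - bounded patches: $\#\mathcal T_H[T]\le C_{\rm patch}$ for all $T\in\mathcal T_H$; - comparable patch elements: $|T|\le C_{\rm size}|T'|$ for all $T\in\mathcal T_H$, $T'\in\mathcal T_H[T]$. Seminorms. A family $\{\|\cdot\|_{Y(\omega)}:\omega\subseteq\overline\Omega\text{ measurable}\}$ of seminorms on a normed space $Y$ is: subadditive if $\|v\|_{Y(\omega_1)}^2+\|v\|_{Y(\omega_2)}^2\le\|v\|_{Y(\omega_1\cup\omega_2)}^2$ for all $v\in Y$ and measurable $\omega_1,\omega_2$ with $|\omega_1\cap\omega_2|=0$; absolutely continuous if $\lim_{|\omega|\to0}\|v\|_{Y(\omega)}=0$ for all $v\in Y$; approximating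 the natural norm if $\|\cdot\|_{Y(\overline\Omega)}=\|\cdot\|_Y$. $D$ is an additional normed space, and $D^\eta,D^\zeta\in D$ are fixed data terms. Estimator properties. Let $0<\rho_{\rm deff}<1$ and $C_{\rm deff}\ge1$ be constants. For $\mathcal U_H\subseteq\mathcal T_H$, $\mathbb T(\mathcal T_H,\mathcal U_H,\rho_{\rm deff})$ is the set of all $\mathcal T_h\in\mathbb T(\mathcal T_H)$ with $|T''|<\rho_{\rm deff}|T'|$ for all $T\in\mathcal U_H$, $T'\in\mathcal T_H[T]$, and $T''\in\mathcal T_h$ with $T''\subseteq T'$. - Local discrete efficiency: for $(v,\xi)\in\{(u,\eta),(z,\zeta)\}$, all $\mathcal T_H\in\mathbb T$, $T\in\mathcal T_H$, $\mathcal T_h\in\mathbb T(\mathcal T_H,\{T\},\rho_{\rm deff})$: $C_{\rm deff}^{-2}\xi_H(T)^2\le\|v_h-v_H\|_{X(\Omega_H[T])}^2+\mathrm{osc}^\xi_H(\mathcal T_H[T])^2$, where $\mathrm{osc}^\xi_H(\mathcal T_H[T])\ge0$ are given oscillation terms. - Boundedness of the oscillation terms: for $(v,\xi)\in\{(u,\eta),(z,\zeta)\}$, all $\mathcal T_H\in\mathbb T$, $T\in\mathcal T_H$: $\mathrm{osc}^\xi_H(\mathcal T_H[T])^2\le w(|T|)\big[\|v_H\|_{X(\Omega_H[T])}^2+\|D^\xi\|_{D(\Omega_H[T])}^2\big]$, where $w:\mathbb R_{\ge0}\to\mathbb R_{\ge0}$ is a monotonously increasing function that is continuous at $0$ with $w(0)=0$.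 - Natural approximation property: for all $\varepsilon>0$ and $\mathcal T_H\in\mathbb T$ there is $\mathcal T_h\in\mathbb T(\mathcal T_H,\mathcal T_H,\rho_{\rm deff})$ with $\|u-u_h\|_X+\|z-z_h\|_X\le\varepsilon$. *)

theory Defs
  imports "HOL-Analysis.Analysis"
begin

section \<open>Domain and meshes\<close>

text \<open>
  Near every boundary point, after a choice of the direction \<open>e\<close> of the last coordinate axis, the
  domain is the part of a ball lying strictly above the graph of a Lipschitz function on the
  hyperplane orthogonal to \<open>e\<close>; \<open>y - (y \<bullet> e) *\<^sub>R e\<close> is the projection of \<open>y\<close> onto that
  hyperplane.
\<close>

definition lipschitz_domain :: "'a::euclidean_space set \<Rightarrow> bool" where
  "lipschitz_domain \<Omega> \<longleftrightarrow>
     open \<Omega> \<and> connected \<Omega> \<and> \<Omega> \<noteq> {} \<and>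
     (\<forall>x\<in>frontier \<Omega>. \<exists>r>0. \<exists>e L. \<exists>\<phi>::'a \<Rightarrow> real.
        norm e = 1 \<and> L-lipschitz_on {y. y \<bullet> e = 0} \<phi> \<and>
        \<Omega> \<inter> ball x r = {y \<in> ball x r. \<phi> (y - (y \<bullet> e) *\<^sub>R e) < y \<bullet> e})"

abbreviation vol :: "'a::euclidean_space set \<Rightarrow> real" where
  "vol \<equiv> measure lebesgue"

type_synonym 'a mesh = "'a set set"

definition is_mesh :: "'a::euclidean_space set \<Rightarrow> 'a mesh \<Rightarrow> bool" where
  "is_mesh \<Omega> H \<longleftrightarrow>
     finite H \<and>
     (\<forall>T\<in>H. compact T \<and> T \<subseteq> closure \<Omega> \<and> vol T > 0) \<and>
     (\<forall>T\<in>H. \<forall>T'\<in>H. T \<noteq> T' \<longrightarrow> vol (T \<inter> T') = 0) \<and>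
     \<Union>H = closure \<Omega>"

section \<open>Refinement\<close>

definition refinement_strategy ::
    "'a::euclidean_space set \<Rightarrow> ('a mesh \<Rightarrow> 'a set set \<Rightarrow> 'a mesh) \<Rightarrow> bool" where
  "refinement_strategy \<Omega> refine \<longleftrightarrow>
     (\<forall>H M. is_mesh \<Omega> H \<and> M \<subseteq> H \<longrightarrow> is_mesh \<Omega> (refine H M))"

inductive_set refinements ::
    "('a mesh \<Rightarrow> 'a set set \<Rightarrow> 'a mesh) \<Rightarrow> 'a mesh \<Rightarrow> 'a mesh set"
  for refine :: "'a mesh \<Rightarrow> 'a set set \<Rightarrow> 'a mesh" and H\<^sub>0 :: "'a mesh"
where
  base: "H\<^sub>0 \<in> refinements refine H\<^sub>0"
| step: "H \<in> refinements refine H\<^sub>0 \<Longrightarrow> M \<subseteq> H \<Longrightarrow> refine H M \<in> refinements refine H\<^sub>0"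

definition patch :: "'a::euclidean_space mesh \<Rightarrow> 'a set \<Rightarrow> 'a set set" where
  "patch H \<omega> = {T \<in> H. closure \<omega> \<inter> T \<noteq> {}}"

definition patch_region :: "'a::euclidean_space mesh \<Rightarrow> 'a set \<Rightarrow> 'a set" where
  "patch_region H \<omega> = \<Union>(patch H \<omega>)"

text \<open>In the following definitions \<open>\<T>\<close> is the set of all admissible meshes.\<close>

definition marking_property ::
    "'a mesh set \<Rightarrow> ('a mesh \<Rightarrow> 'a set set \<Rightarrow> 'a mesh) \<Rightarrow> bool" where
  "marking_property \<T> refine \<longleftrightarrow> (\<forall>H\<in>\<T>. \<forall>M. M \<subseteq> H \<longrightarrow> M \<subseteq> H - refine H M)"

definition child_property ::
    "'a mesh set \<Rightarrow> ('a mesh \<Rightarrow> 'a set set \<Rightarrow> 'a mesh) \<Rightarrow> bool" where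
  "child_property \<T> refine \<longleftrightarrow>
     (\<forall>H\<in>\<T>. \<forall>M. M \<subseteq> H \<longrightarrow> (\<forall>T\<in>H. T = \<Union>{T' \<in> refine H M. T' \<subseteq> T}))"

definition uniform_size_reduction ::
    "'a::euclidean_space mesh set \<Rightarrow> ('a mesh \<Rightarrow> 'a set set \<Rightarrow> 'a mesh) \<Rightarrow> real \<Rightarrow> bool" where
  "uniform_size_reduction \<T> refine \<rho> \<longleftrightarrow>
     (\<forall>H\<in>\<T>. \<forall>M. M \<subseteq> H \<longrightarrow>
        (\<forall>T \<in> H - refine H M. \<forall>T' \<in> refine H M. T' \<subseteq> T \<longrightarrow> vol T' < \<rho> * vol T))"

definition bounded_patches :: "'a::euclidean_space mesh set \<Rightarrow> real \<Rightarrow> bool" where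
  "bounded_patches \<T> C \<longleftrightarrow> (\<forall>H\<in>\<T>. \<forall>T\<in>H. real (card (patch H T)) \<le> C)"

definition comparable_patch_elements :: "'a::euclidean_space mesh set \<Rightarrow> real \<Rightarrow> bool" where
  "comparable_patch_elements \<T> C \<longleftrightarrow>
     (\<forall>H\<in>\<T>. \<forall>T\<in>H. \<forall>T'\<in>patch H T. vol T \<le> C * vol T')"

section \<open>Families of seminorms\<close>

text \<open>\<open>sn \<omega> v\<close> is the value at \<open>v\<close> of the seminorm on \<open>\<omega>\<close>; it is only constrained for measurable
  \<open>\<omega> \<subseteq> closure \<Omega>\<close>.\<close>

definition measurable_parts :: "'a::euclidean_space set \<Rightarrow> 'a set set" where
  "measurable_parts \<Omega> = {\<omega> \<in> sets lebesgue. \<omega> \<subseteq> closure \<Omega>}"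

definition is_seminorm :: "('y::real_normed_vector \<Rightarrow> real) \<Rightarrow> bool" where
  "is_seminorm p \<longleftrightarrow>
     (\<forall>v. 0 \<le> p v) \<and>
     (\<forall>c v. p (c *\<^sub>R v) = \<bar>c\<bar> * p v) \<and>
     (\<forall>v v'. p (v + v') \<le> p v + p v')"

definition seminorm_family ::
    "'a::euclidean_space set \<Rightarrow> ('a set \<Rightarrow> 'y::real_normed_vector \<Rightarrow> real) \<Rightarrow> bool" where
  "seminorm_family \<Omega> sn \<longleftrightarrow> (\<forall>\<omega>\<in>measurable_parts \<Omega>. is_seminorm (sn \<omega>))"

definition subadditive_family ::
    "'a::euclidean_space set \<Rightarrow> ('a set \<Rightarrow> 'y::real_normed_vector \<Rightarrow> real) \<Rightarrow> bool" where
  "subadditive_family \<Omega> sn \<longleftrightarrow>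
     (\<forall>v. \<forall>\<omega>\<^sub>1\<in>measurable_parts \<Omega>. \<forall>\<omega>\<^sub>2\<in>measurable_parts \<Omega>.
        vol (\<omega>\<^sub>1 \<inter> \<omega>\<^sub>2) = 0 \<longrightarrow> (sn \<omega>\<^sub>1 v)\<^sup>2 + (sn \<omega>\<^sub>2 v)\<^sup>2 \<le> (sn (\<omega>\<^sub>1 \<union> \<omega>\<^sub>2) v)\<^sup>2)"

definition abs_continuous_family ::
    "'a::euclidean_space set \<Rightarrow> ('a set \<Rightarrow> 'y::real_normed_vector \<Rightarrow> real) \<Rightarrow> bool" where
  "abs_continuous_family \<Omega> sn \<longleftrightarrow>
     (\<forall>v. \<forall>\<epsilon>>0. \<exists>\<delta>>0. \<forall>\<omega>\<in>measurable_parts \<Omega>. vol \<omega> < \<delta> \<longrightarrow> sn \<omega> v < \<epsilon>)"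

definition approximates_natural_norm ::
    "'a::euclidean_space set \<Rightarrow> ('a set \<Rightarrow> 'y::real_normed_vector \<Rightarrow> real) \<Rightarrow> bool" where
  "approximates_natural_norm \<Omega> sn \<longleftrightarrow> (\<forall>v. sn (closure \<Omega>) v = norm v)"

section \<open>Estimators, marking and the adaptive algorithm\<close>

definition estimator :: "('a mesh \<Rightarrow> 'a set \<Rightarrow> real) \<Rightarrow> 'a mesh \<Rightarrow> 'a set set \<Rightarrow> real" where
  "estimator \<xi> H U = sqrt (\<Sum>T\<in>U. (\<xi> H T)\<^sup>2)"

definition max_indicator :: "('a mesh \<Rightarrow> 'a set \<Rightarrow> real) \<Rightarrow> 'a mesh \<Rightarrow> 'a set set \<Rightarrow> real" where
  "max_indicator \<xi> H U = (if U = {} then 0 else Max (\<xi> H ` U))"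

definition marking_function_A :: "(real \<Rightarrow> real \<Rightarrow> real) \<Rightarrow> bool" where
  "marking_function_A V \<longleftrightarrow>
     (\<forall>x\<ge>0. \<forall>y\<ge>0. 0 \<le> V x y) \<and>
     continuous (at (0, 0) within {0..} \<times> {0..}) (\<lambda>(x, y). V x y) \<and>
     V 0 0 = 0"

definition marking_A ::
    "('a mesh \<Rightarrow> 'a set \<Rightarrow> real) \<Rightarrow> ('a mesh \<Rightarrow> 'a set \<Rightarrow> real) \<Rightarrow> (real \<Rightarrow> real \<Rightarrow> real) \<Rightarrow>
     'a mesh \<Rightarrow> 'a set set \<Rightarrow> bool" where
  "marking_A \<eta> \<zeta> V H M \<longleftrightarrow>
     max_indicator \<eta> H (H - M) * max_indicator \<zeta> H (H - M)
       \<le> V (estimator \<eta> H M) (estimator \<zeta> H M)"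

definition marking_function_B :: "(real \<Rightarrow> real \<Rightarrow> real) \<Rightarrow> real \<Rightarrow> bool" where
  "marking_function_B W C\<^sub>W \<longleftrightarrow>
     (\<forall>x\<ge>0. \<forall>y\<ge>0. 0 \<le> W x y) \<and>
     W 1 1 = 1 \<and>
     C\<^sub>W > 0 \<and>
     (\<forall>x\<in>{0..1}. \<forall>y\<in>{0..1}. W x y \<le> C\<^sub>W * max x y)"

definition marking_B ::
    "('a mesh \<Rightarrow> 'a set \<Rightarrow> real) \<Rightarrow> ('a mesh \<Rightarrow> 'a set \<Rightarrow> real) \<Rightarrow> (real \<Rightarrow> real \<Rightarrow> real) \<Rightarrow> real \<Rightarrow>
     'a mesh \<Rightarrow> 'a set set \<Rightarrow> bool" where
  "marking_B \<eta> \<zeta> W \<theta> H M \<longleftrightarrow>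
     \<theta> \<le> W ((estimator \<eta> H M)\<^sup>2 / (estimator \<eta> H H)\<^sup>2)
            ((estimator \<zeta> H M)\<^sup>2 / (estimator \<zeta> H H)\<^sup>2)"

text \<open>\<open>mark H M\<close> states that \<open>M\<close> is an allowed choice of marked elements in \<open>H\<close>. Marking takes
  place only as long as the algorithm has not stopped, so the quotients in \<^const>\<open>marking_B\<close> then
  have nonzero denominators.\<close>

definition adaptive_algorithm ::
    "('a mesh \<Rightarrow> 'a set set \<Rightarrow> 'a mesh) \<Rightarrow> 'a mesh \<Rightarrow>
     ('a mesh \<Rightarrow> 'a set \<Rightarrow> real) \<Rightarrow> ('a mesh \<Rightarrow> 'a set \<Rightarrow> real) \<Rightarrow>
     ('a mesh \<Rightarrow> 'a set set \<Rightarrow> bool) \<Rightarrow> (nat \<Rightarrow> 'a mesh) \<Rightarrow> (nat \<Rightarrow> 'a set set) \<Rightarrow> bool" where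
  "adaptive_algorithm refine H\<^sub>0 \<eta> \<zeta> mark \<T>\<^sub>l M \<longleftrightarrow>
     (let stop = (\<lambda>l. estimator \<eta> (\<T>\<^sub>l l) (\<T>\<^sub>l l) * estimator \<zeta> (\<T>\<^sub>l l) (\<T>\<^sub>l l) = 0) in
       \<T>\<^sub>l 0 = H\<^sub>0 \<and>
       (\<forall>l. (\<forall>k\<le>l. \<not> stop k) \<longrightarrow>
          M l \<subseteq> \<T>\<^sub>l l \<and> mark (\<T>\<^sub>l l) (M l) \<and> \<T>\<^sub>l (Suc l) = refine (\<T>\<^sub>l l) (M l)) \<and>
       (\<forall>l\<^sub>0. stop l\<^sub>0 \<and> (\<forall>k<l\<^sub>0. \<not> stop k) \<longrightarrow> (\<forall>l\<ge>l\<^sub>0. \<T>\<^sub>l l = \<T>\<^sub>l l\<^sub>0)))"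

section \<open>Properties of the estimators\<close>

definition sufficiently_refined ::
    "('a::euclidean_space mesh \<Rightarrow> 'a set set \<Rightarrow> 'a mesh) \<Rightarrow> 'a mesh \<Rightarrow> 'a set set \<Rightarrow> real \<Rightarrow>
     'a mesh set" where
  "sufficiently_refined refine H U \<rho> =
     {h \<in> refinements refine H.
        \<forall>T\<in>U. \<forall>T'\<in>patch H T. \<forall>T''\<in>h. T'' \<subseteq> T' \<longrightarrow> vol T'' < \<rho> * vol T'}"

text \<open>\<open>osc H (patch H T)\<close> is the oscillation term on the patch of \<open>T\<close>.\<close>

definition local_discrete_efficiency ::
    "'a::euclidean_space mesh set \<Rightarrow> ('a mesh \<Rightarrow> 'a set set \<Rightarrow> 'a mesh) \<Rightarrow>
     ('a set \<Rightarrow> 'x::real_normed_vector \<Rightarrow> real) \<Rightarrow> real \<Rightarrow> real \<Rightarrow>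
     ('a mesh \<Rightarrow> 'x) \<Rightarrow> ('a mesh \<Rightarrow> 'a set \<Rightarrow> real) \<Rightarrow> ('a mesh \<Rightarrow> 'a set set \<Rightarrow> real) \<Rightarrow> bool" where
  "local_discrete_efficiency \<T> refine snX \<rho> C v \<xi> osc \<longleftrightarrow>
     (\<forall>H\<in>\<T>. \<forall>T\<in>H. \<forall>h\<in>sufficiently_refined refine H {T} \<rho>.
        (\<xi> H T)\<^sup>2 / C\<^sup>2 \<le> (snX (patch_region H T) (v h - v H))\<^sup>2 + (osc H (patch H T))\<^sup>2)"

definition oscillation_bounded ::
    "'a::euclidean_space mesh set \<Rightarrow>
     ('a set \<Rightarrow> 'x::real_normed_vector \<Rightarrow> real) \<Rightarrow> ('a set \<Rightarrow> 'd::real_normed_vector \<Rightarrow> real) \<Rightarrow>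
     (real \<Rightarrow> real) \<Rightarrow> ('a mesh \<Rightarrow> 'x) \<Rightarrow> 'd \<Rightarrow> ('a mesh \<Rightarrow> 'a set set \<Rightarrow> real) \<Rightarrow> bool" where
  "oscillation_bounded \<T> snX snD w v D osc \<longleftrightarrow>
     (\<forall>H\<in>\<T>. \<forall>T\<in>H.
        (osc H (patch H T))\<^sup>2
          \<le> w (vol T) * ((snX (patch_region H T) (v H))\<^sup>2 + (snD (patch_region H T) D)\<^sup>2))"

definition oscillation_weight :: "(real \<Rightarrow> real) \<Rightarrow> bool" where
  "oscillation_weight w \<longleftrightarrow>
     (\<forall>t\<ge>0. 0 \<le> w t) \<and> mono_on {0..} w \<and> continuous (at 0 within {0..}) w \<and> w 0 = 0"

definition natural_approximation ::
    "'a::euclidean_space mesh set \<Rightarrow> ('a mesh \<Rightarrow> 'a set set \<Rightarrow> 'a mesh) \<Rightarrow> real \<Rightarrow>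
     'x::real_normed_vector \<Rightarrow> 'x \<Rightarrow> ('a mesh \<Rightarrow> 'x) \<Rightarrow> ('a mesh \<Rightarrow> 'x) \<Rightarrow> bool" where
  "natural_approximation \<T> refine \<rho> u z u\<^sub>d z\<^sub>d \<longleftrightarrow>
     (\<forall>\<epsilon>>0. \<forall>H\<in>\<T>. \<exists>h\<in>sufficiently_refined refine H H \<rho>.
        norm (u - u\<^sub>d h) + norm (z - z\<^sub>d h) \<le> \<epsilon>)"

end

theory Submission
  imports Defs
begin

text \<open>
  The adaptive algorithm may converge to limits \<open>u_inf\<close> and \<open>z_inf\<close> different from the exact solutions
  \<open>u\<close> and \<open>z\<close>, so the indicators cannot be controlled by the errors of \<open>u\<close> and \<open>z\<close>. The decisive fact is
  that the indicators on \<^emph>\<open>small\<close> elements are negligible: for every tolerance there is a \<open>c > 0\<close>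
  such that, for all late meshes, the part of the estimator on elements of volume less than \<open>c\<close> is
  below the tolerance (lemma \<open>small_elements_estimator\<close>).

  Refinement decreases the sum of the squared volumes, by at least a fixed fraction of
  the squared volumes of the refined elements (\<open>refine_sum_squares\<close>). Hence the volumes of refined
  elements tend to zero, and every late element of volume bounded below is persistent, that is, it
  is never refined again. Now let \<open>T\<close> be a small element of a late mesh. If all elements of its patch
  are eventually sufficiently refined, local discrete efficiency bounds the indicator at \<open>T\<close> by the
  difference of two late discrete solutions, which form a Cauchy sequence. Otherwise some element
  of the patch contains a persistent element of comparable volume. Persistent elements have a
  finite total volume, so the small ones among them have little volume altogether, and so has the
  region covered by the patches of all such \<open>T\<close> (\<open>near_persistent_region_small\<close>). Local discrete
  efficiency for a mesh from the natural approximation property and absolute continuity of the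
  seminorms then show that their indicators are small. Summation over overlapping patches is
  justified by \<open>sum_patch_seminorms\<close>.

  Marked elements are refined and therefore small, so both estimators tend to zero on the marked
  elements (\<open>marked_estimator_vanishes\<close>). Under Marking Strategy B, one of the two estimators is
  bounded by a multiple of its marked part while the other one is bounded, and the product tends
  to zero. Under Marking Strategy A, the elements that are not small are unmarked and bounded in
  number, so their parts of the two estimators have a product that is bounded by a multiple of the
  product of the maximal unmarked indicators, which tends to zero by continuity of \<open>V\<close>; the
  remaining parts are negligible.
\<close>

section \<open>Families of seminorms\<close>

text \<open>
  Greedy selection: the element with the largest weight, together with the at most \<open>n\<close> elements in
  conflict with it, contributes at most \<open>n\<close> times its weight; it is kept, its neighbours are removed,
  and the procedure is repeated.
\<close>

lemma sum_le_independent_subset: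
  fixes a :: "'b \<Rightarrow> real" and n :: real
  assumes "finite U" and "symp R" and "\<And>x. x \<in> U \<Longrightarrow> R x x"
    and "\<And>x. x \<in> U \<Longrightarrow> real (card {y \<in> U. R x y}) \<le> n" and "\<And>x. x \<in> U \<Longrightarrow> 0 \<le> a x"
  shows "\<exists>I\<subseteq>U. pairwise (\<lambda>x y. \<not> R x y) I \<and> sum a U \<le> n * sum a I"
  using assms(1,3-)
proof (induction rule: finite_psubset_induct)
  case (psubset U)
  show ?case
  proof (cases "U = {}")
    case False
    have "Max (a ` U) \<in> a ` U" using psubset.hyps(1) False by simp
    then obtain x where x: "x \<in> U" "a x = Max (a ` U)" by auto
    have ax: "a y \<le> a x" if "y \<in> U" for y using psubset.hyps(1) that x by simp
    define N where "N = {y \<in> U. R x y}"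
    have sub: "U - N \<subset> U" using x psubset.prems(1) by (auto simp: N_def)
    have "\<exists>I\<subseteq>U - N. pairwise (\<lambda>x y. \<not> R x y) I \<and> sum a (U - N) \<le> n * sum a I"
    proof (rule psubset.IH[OF sub])
      fix y assume y: "y \<in> U - N"
      have "card {z \<in> U - N. R y z} \<le> card {z \<in> U. R y z}"
        using psubset.hyps(1) by (intro card_mono) auto
      then show "real (card {z \<in> U - N. R y z}) \<le> n" using psubset.prems(2)[of y] y by simp
    qed (use psubset.prems in auto)
    then obtain I where I: "I \<subseteq> U - N" "pairwise (\<lambda>x y. \<not> R x y) I" "sum a (U - N) \<le> n * sum a I"
      by blast
    have xI: "x \<notin> I" using I(1) x psubset.prems(1) by (auto simp: N_def)
    have finI: "finite I" using I(1) psubset.hyps(1) by (meson Diff_subset finite_subset)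
    have "sum a U = sum a N + sum a (U - N)"
      using psubset.hyps(1) sum.subset_diff[of N U a] by (auto simp: N_def)
    also have "sum a N \<le> real (card N) * a x"
      using ax by (intro sum_bounded_above) (auto simp: N_def)
    also have "\<dots> \<le> n * a x"
      using psubset.prems(2,3)[of x] x by (intro mult_right_mono) (auto simp: N_def)
    finally have "sum a U \<le> n * sum a (insert x I)"
      using I(3) xI finI by (simp add: algebra_simps)
    moreover have "pairwise (\<lambda>x y. \<not> R x y) (insert x I)"
      using I(1,2) sympD[OF assms(2)] by (auto simp: pairwise_insert N_def)
    ultimately show ?thesis using I(1) x by (intro exI[of _ "insert x I"]) auto
  qed auto
qed

lemma measurable_parts_lmeasurable:
  "bounded \<Omega> \<Longrightarrow> \<omega> \<in> measurable_parts \<Omega> \<Longrightarrow> \<omega> \<in> lmeasurable"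
  unfolding measurable_parts_def
  by (metis (lifting) bounded_closure bounded_set_imp_lmeasurable bounded_subset mem_Collect_eq)

lemma measurable_parts_Union:
  "finite F \<Longrightarrow> F \<subseteq> measurable_parts \<Omega> \<Longrightarrow> \<Union>F \<in> measurable_parts \<Omega>"
  unfolding measurable_parts_def by (auto intro!: sets.finite_Union)

lemma seminorm_family_nonneg:
  "seminorm_family \<Omega> sn \<Longrightarrow> \<omega> \<in> measurable_parts \<Omega> \<Longrightarrow> 0 \<le> sn \<omega> v"
  by (auto simp: seminorm_family_def is_seminorm_def)

lemma seminorm_family_triangle:
  "seminorm_family \<Omega> sn \<Longrightarrow> \<omega> \<in> measurable_parts \<Omega> \<Longrightarrow> sn \<omega> (v + v') \<le> sn \<omega> v + sn \<omega> v'"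
  by (auto simp: seminorm_family_def is_seminorm_def)

lemma subadditive_family_mono:
  assumes sn: "seminorm_family \<Omega> sn" and sub: "subadditive_family \<Omega> sn"
    and m: "\<omega>\<^sub>1 \<in> measurable_parts \<Omega>" "\<omega>\<^sub>2 \<in> measurable_parts \<Omega>" "\<omega>\<^sub>1 \<subseteq> \<omega>\<^sub>2"
  shows "sn \<omega>\<^sub>1 v \<le> sn \<omega>\<^sub>2 v"
proof -
  have d: "\<omega>\<^sub>2 - \<omega>\<^sub>1 \<in> measurable_parts \<Omega>" using m by (auto simp: measurable_parts_def)
  have "vol (\<omega>\<^sub>1 \<inter> (\<omega>\<^sub>2 - \<omega>\<^sub>1)) = 0" by simp
  then have "(sn \<omega>\<^sub>1 v)\<^sup>2 + (sn (\<omega>\<^sub>2 - \<omega>\<^sub>1) v)\<^sup>2 \<le> (sn (\<omega>\<^sub>1 \<union> (\<omega>\<^sub>2 - \<omega>\<^sub>1)) v)\<^sup>2"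
    using sub m d unfolding subadditive_family_def by blast
  moreover have "\<omega>\<^sub>1 \<union> (\<omega>\<^sub>2 - \<omega>\<^sub>1) = \<omega>\<^sub>2" using m by auto
  ultimately have "(sn \<omega>\<^sub>1 v)\<^sup>2 \<le> (sn \<omega>\<^sub>2 v)\<^sup>2"
    by (smt (verit) zero_le_power2)
  then show ?thesis using seminorm_family_nonneg[OF sn m(2)] by (rule power2_le_imp_le)
qed

lemma subadditive_family_le_norm:
  assumes "seminorm_family \<Omega> sn" "subadditive_family \<Omega> sn" "approximates_natural_norm \<Omega> sn"
    "\<omega> \<in> measurable_parts \<Omega>"
  shows "sn \<omega> v \<le> norm v"
proof -
  have "closure \<Omega> \<in> measurable_parts \<Omega>" by (auto simp: measurable_parts_def)
  then have "sn \<omega> v \<le> sn (closure \<Omega>) v"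
    using assms by (intro subadditive_family_mono[of \<Omega>]) (auto simp: measurable_parts_def)
  then show ?thesis using assms(3) by (simp add: approximates_natural_norm_def)
qed

lemma subadditive_family_sum:
  assumes bd: "bounded \<Omega>" and sub: "subadditive_family \<Omega> sn" and "finite I"
    and "\<And>i. i \<in> I \<Longrightarrow> F i \<in> measurable_parts \<Omega>"
    and "pairwise (\<lambda>i j. vol (F i \<inter> F j) = 0) I"
  shows "(\<Sum>i\<in>I. (sn (F i) v)\<^sup>2) \<le> (sn (\<Union>i\<in>I. F i) v)\<^sup>2"
  using assms(3-)
proof (induction rule: finite_induct)
  case (insert i I)
  have part: "F j \<in> measurable_parts \<Omega>" if "j \<in> insert i I" for j
    using insert.prems(1) that by simp
  have U: "(\<Union>i\<in>I. F i) \<in> measurable_parts \<Omega>"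
    using insert.hyps(1) part by (intro measurable_parts_Union) auto
  have pw: "pairwise (\<lambda>i j. vol (F i \<inter> F j) = 0) I" "\<And>j. j \<in> I \<Longrightarrow> vol (F i \<inter> F j) = 0"
    using insert.prems(2) insert.hyps(2) by (auto simp: pairwise_def)
  have IH: "(\<Sum>i\<in>I. (sn (F i) v)\<^sup>2) \<le> (sn (\<Union>i\<in>I. F i) v)\<^sup>2"
    using insert.IH part pw(1) by simp
  have "negligible (F i \<inter> F j)" if "j \<in> I" for j
    unfolding negligible_iff_measure
    using pw(2)[OF that] that part measurable_parts_lmeasurable[OF bd] by (simp add: fmeasurable.Int)
  then have "negligible (\<Union>j\<in>I. F i \<inter> F j)"
    using insert.hyps(1) by (intro negligible_Union) auto
  then have "vol (F i \<inter> (\<Union>j\<in>I. F j)) = 0"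
    unfolding Int_UN_distrib by (rule negligible_imp_measure0)
  then have "(sn (F i) v)\<^sup>2 + (sn (\<Union>j\<in>I. F j) v)\<^sup>2 \<le> (sn (F i \<union> (\<Union>j\<in>I. F j)) v)\<^sup>2"
    using sub[unfolded subadditive_family_def, rule_format, OF part[of i] U] by simp
  moreover have "(\<Sum>j\<in>insert i I. (sn (F j) v)\<^sup>2) = (sn (F i) v)\<^sup>2 + (\<Sum>j\<in>I. (sn (F j) v)\<^sup>2)"
    using insert.hyps by simp
  ultimately show ?case using IH by simp
qed simp

section \<open>Meshes and overlapping patches\<close>

lemma is_meshD:
  assumes "is_mesh \<Omega> H"
  shows "finite H" and "\<And>T. T \<in> H \<Longrightarrow> compact T" and "\<And>T. T \<in> H \<Longrightarrow> T \<subseteq> closure \<Omega>"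
    and "\<And>T. T \<in> H \<Longrightarrow> vol T > 0" and "\<Union>H = closure \<Omega>"
    and "\<And>T T'. T \<in> H \<Longrightarrow> T' \<in> H \<Longrightarrow> T \<noteq> T' \<Longrightarrow> vol (T \<inter> T') = 0"
    and "H \<subseteq> measurable_parts \<Omega>" and "\<And>T. T \<in> H \<Longrightarrow> T \<in> lmeasurable"
  using assms
  by (simp_all add: is_mesh_def measurable_parts_def lmeasurable_compact fmeasurableD subset_iff)

lemma mesh_element_unique:
  assumes H: "is_mesh \<Omega> H" and "T \<in> H" "T' \<in> H" "S \<subseteq> T" "S \<subseteq> T'" "S \<in> lmeasurable" "vol S > 0"
  shows "T = T'"
proof (rule ccontr)
  assume "T \<noteq> T'"
  then have "vol (T \<inter> T') = 0" using is_meshD(6)[OF H] assms by blast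
  moreover have "vol S \<le> vol (T \<inter> T')"
    using assms is_meshD(8)[OF H] by (intro measure_mono_fmeasurable) auto
  ultimately show False using assms(7) by simp
qed

lemma mesh_measure_Union:
  assumes H: "is_mesh \<Omega> H" and U: "U \<subseteq> H"
  shows "vol (\<Union>U) = sum vol U"
proof (rule measure_negligible_finite_Union)
  show "finite U" using is_meshD(1)[OF H] U finite_subset by blast
  show "pairwise (\<lambda>S T. negligible (S \<inter> T)) U"
    using is_meshD(6,8)[OF H] U
    by (auto simp: pairwise_def negligible_iff_measure subset_iff)
qed (use is_meshD(8)[OF H] U in auto)

lemma mesh_sum_vol_le:
  assumes "bounded \<Omega>" and H: "is_mesh \<Omega> H" and U: "U \<subseteq> H" and S: "\<Union>U \<subseteq> S" "S \<in> lmeasurable"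
  shows "sum vol U \<le> vol S"
proof -
  have "U \<subseteq> measurable_parts \<Omega>" "finite U"
    using is_meshD(1,7)[OF H] U by (auto intro: finite_subset)
  then have "\<Union>U \<in> lmeasurable"
    using measurable_parts_Union measurable_parts_lmeasurable[OF assms(1)] by blast
  then have "vol (\<Union>U) \<le> vol S"
    using S by (intro measure_mono_fmeasurable) (simp_all add: fmeasurableD)
  then show ?thesis using mesh_measure_Union[OF H U] by simp
qed

lemma patch_self: "T \<in> H \<Longrightarrow> T \<noteq> {} \<Longrightarrow> T \<in> patch H T"
  using closure_subset[of T] by (auto simp: patch_def)

lemma patch_sym:
  assumes "is_mesh \<Omega> H" "T \<in> H" "T' \<in> patch H T"
  shows "T \<in> patch H T'"
  using assms is_meshD(2)[OF assms(1)] by (auto simp: patch_def compact_imp_closed)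

lemma patch_region_parts:
  assumes "is_mesh \<Omega> H"
  shows "patch_region H \<omega> \<in> measurable_parts \<Omega>"
  unfolding patch_region_def using is_meshD(1,7)[OF assms]
  by (intro measurable_parts_Union) (auto simp: patch_def)

text \<open>
  Subadditivity only concerns sets that overlap in null sets, whereas patches of different elements
  may share elements. Two patches are in conflict if they do; since every patch has at most \<open>C\<close>
  elements, each patch is in conflict with at most \<open>C\<^sup>2\<close> patches, so an independent subfamily carries
  the sum up to this factor.
\<close>
lemma sum_patch_seminorms:
  assumes bd: "bounded \<Omega>" and H: "is_mesh \<Omega> H" and U: "U \<subseteq> H"
    and sub: "subadditive_family \<Omega> sn"
    and sn: "seminorm_family \<Omega> sn"
    and card: "\<And>T. T \<in> H \<Longrightarrow> real (card (patch H T)) \<le> C" and C: "0 \<le> C"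
  shows "(\<Sum>T\<in>U. (sn (patch_region H T) v)\<^sup>2) \<le> C\<^sup>2 * (sn (\<Union>T\<in>U. patch_region H T) v)\<^sup>2"
proof -
  define R where "R = (\<lambda>T T'. patch H T \<inter> patch H T' \<noteq> {})"
  note finH = is_meshD(1)[OF H]
  have finU: "finite U" using finH U finite_subset by blast
  have fp: "finite (patch H S)" for S using finH by (simp add: patch_def)
  have ne: "T \<noteq> {}" if "T \<in> H" for T using is_meshD(4)[OF H that] by auto
  have "\<exists>I\<subseteq>U. pairwise (\<lambda>T T'. \<not> R T T') I \<and>
      (\<Sum>T\<in>U. (sn (patch_region H T) v)\<^sup>2) \<le> C\<^sup>2 * (\<Sum>T\<in>I. (sn (patch_region H T) v)\<^sup>2)"
  proof (rule sum_le_independent_subset[OF finU])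
    show "symp R" by (auto simp: R_def symp_def)
    show "R T T" if "T \<in> U" for T
      using patch_self[of T H] ne that U by (auto simp: R_def)
    show "real (card {T' \<in> U. R T T'}) \<le> C\<^sup>2" if "T \<in> U" for T
    proof -
      have T: "T \<in> H" using that U by auto
      have sub: "{T' \<in> U. R T T'} \<subseteq> (\<Union>S\<in>patch H T. patch H S)"
      proof safe
        fix T' assume "T' \<in> U" "R T T'"
        then obtain S where "S \<in> patch H T" "S \<in> patch H T'" by (auto simp: R_def)
        then show "T' \<in> (\<Union>S\<in>patch H T. patch H S)"
          using patch_sym[OF H, of T' S] \<open>T' \<in> U\<close> U by auto
      qed
      have "card {T' \<in> U. R T T'} \<le> card (\<Union>S\<in>patch H T. patch H S)"
        using sub fp by (intro card_mono) auto
      also have "\<dots> \<le> (\<Sum>S\<in>patch H T. card (patch H S))"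
        using fp by (intro card_UN_le)
      finally have "real (card {T' \<in> U. R T T'}) \<le> (\<Sum>S\<in>patch H T. real (card (patch H S)))"
        by (metis of_nat_le_iff of_nat_sum)
      also have "\<dots> \<le> real (card (patch H T)) * C"
        using card by (intro sum_bounded_above) (auto simp: patch_def)
      also have "\<dots> \<le> C * C" using card[OF T] C by (intro mult_right_mono)
      finally show ?thesis by (simp add: power2_eq_square)
    qed
  qed auto
  then obtain I where I: "I \<subseteq> U" "pairwise (\<lambda>T T'. \<not> R T T') I"
    "(\<Sum>T\<in>U. (sn (patch_region H T) v)\<^sup>2) \<le> C\<^sup>2 * (\<Sum>T\<in>I. (sn (patch_region H T) v)\<^sup>2)"
    by blast
  have finI: "finite I" using I finU finite_subset by blast
  have "(\<Sum>T\<in>I. (sn (patch_region H T) v)\<^sup>2) \<le> (sn (\<Union>T\<in>I. patch_region H T) v)\<^sup>2"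
  proof (rule subadditive_family_sum[OF bd sub finI patch_region_parts[OF H]])
    show "pairwise (\<lambda>T T'. vol (patch_region H T \<inter> patch_region H T') = 0) I"
    proof (rule pairwiseI)
      fix T T' assume "T \<in> I" "T' \<in> I" "T \<noteq> T'"
      then have nR: "\<not> R T T'" using I(2) by (auto simp: pairwise_def)
      have "negligible (S \<inter> S')" if "S \<in> patch H T" "S' \<in> patch H T'" for S S'
      proof -
        have "S \<in> H" "S' \<in> H" "S \<noteq> S'" using that nR by (auto simp: R_def patch_def)
        then show ?thesis using is_meshD(6,8)[OF H] by (auto simp: negligible_iff_measure)
      qed
      then have "negligible (\<Union>S'\<in>patch H T'. S \<inter> S')" if "S \<in> patch H T" for S
        using fp that by (intro negligible_Union) auto
      then have "negligible (\<Union>S\<in>patch H T. \<Union>S'\<in>patch H T'. S \<inter> S')"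
        using fp by (intro negligible_Union) auto
      moreover have "patch_region H T \<inter> patch_region H T' = (\<Union>S\<in>patch H T. \<Union>S'\<in>patch H T'. S \<inter> S')"
        by (auto simp: patch_region_def)
      ultimately show "vol (patch_region H T \<inter> patch_region H T') = 0"
        by (simp add: negligible_iff_measure)
    qed
  qed
  also have "\<dots> \<le> (sn (\<Union>T\<in>U. patch_region H T) v)\<^sup>2"
  proof (rule power_mono)
    show "sn (\<Union>T\<in>I. patch_region H T) v \<le> sn (\<Union>T\<in>U. patch_region H T) v"
      using I finI finU patch_region_parts[OF H]
      by (intro subadditive_family_mono[OF sn sub] measurable_parts_Union) auto
    show "0 \<le> sn (\<Union>T\<in>I. patch_region H T) v"
      using finI patch_region_parts[OF H]
      by (intro seminorm_family_nonneg[OF sn] measurable_parts_Union) auto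
  qed
  finally show ?thesis using I(3)
    by (meson mult_left_mono order_trans zero_le_power2)
qed

section \<open>Volumes in a sequence of refined meshes\<close>

text \<open>
  A run of the adaptive algorithm that never stops, as far as it concerns the meshes only: the
  marking criterion plays no role here.
\<close>

locale adaptive_meshes =
  fixes \<Omega> :: "'a::euclidean_space set"
    and refine :: "'a mesh \<Rightarrow> 'a set set \<Rightarrow> 'a mesh"
    and H\<^sub>0 :: "'a mesh" and \<T>\<^sub>l :: "nat \<Rightarrow> 'a mesh" and M :: "nat \<Rightarrow> 'a set set"
    and \<rho>_child C_patch C_size :: real
  assumes bounded_domain: "bounded \<Omega>"
    and strategy: "refinement_strategy \<Omega> refine"
    and initial_mesh: "is_mesh \<Omega> H\<^sub>0"
    and child: "child_property (refinements refine H\<^sub>0) refine"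
    and size_reduction: "uniform_size_reduction (refinements refine H\<^sub>0) refine \<rho>_child"
    and child_factor: "0 < \<rho>_child" "\<rho>_child < 1"
    and patches: "bounded_patches (refinements refine H\<^sub>0) C_patch"
    and comparable: "comparable_patch_elements (refinements refine H\<^sub>0) C_size"
    and constants: "1 \<le> C_patch" "1 \<le> C_size"
    and start: "\<T>\<^sub>l 0 = H\<^sub>0"
    and marked: "M l \<subseteq> \<T>\<^sub>l l"
    and refined: "\<T>\<^sub>l (Suc l) = refine (\<T>\<^sub>l l) (M l)"
begin

abbreviation admissible :: "'a mesh set" where
  "admissible \<equiv> refinements refine H\<^sub>0"

lemma admissible_mesh: "H \<in> admissible \<Longrightarrow> is_mesh \<Omega> H"
  by (induction rule: refinements.induct)
    (use initial_mesh strategy in \<open>auto simp: refinement_strategy_def\<close>)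

lemma sequence_refines: "l \<le> m \<Longrightarrow> \<T>\<^sub>l m \<in> refinements refine (\<T>\<^sub>l l)"
  by (induction m rule: dec_induct)
    (simp_all add: refined refinements.base refinements.step[OF _ marked])

lemma sequence_admissible: "\<T>\<^sub>l l \<in> admissible"
  using sequence_refines[of 0 l] by (simp add: start)

lemma sequence_mesh: "is_mesh \<Omega> (\<T>\<^sub>l l)"
  by (rule admissible_mesh[OF sequence_admissible])

lemma card_patch: "H \<in> admissible \<Longrightarrow> T \<in> H \<Longrightarrow> real (card (patch H T)) \<le> C_patch"
  using patches by (auto simp: bounded_patches_def)

lemma vol_patch: "H \<in> admissible \<Longrightarrow> T \<in> H \<Longrightarrow> T' \<in> patch H T \<Longrightarrow> vol T \<le> C_size * vol T'"
  using comparable by (auto simp: comparable_patch_elements_def)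

lemma vol_patch': "H \<in> admissible \<Longrightarrow> T \<in> H \<Longrightarrow> T' \<in> patch H T \<Longrightarrow> vol T' \<le> C_size * vol T"
  using vol_patch[of H T' T] patch_sym[OF admissible_mesh, of H T T'] by (auto simp: patch_def)

text \<open>
  The child property states that every element of the coarse mesh is covered by its children. That,
  conversely, every new element is a child of some old one holds because elements have positive
  volume: the children cover the whole domain, and a further element would overlap all of them in
  null sets only.
\<close>

lemma parent_exists:
  assumes H: "H \<in> admissible" and N: "N \<subseteq> H" and S: "S \<in> refine H N"
  shows "\<exists>T\<in>H. S \<subseteq> T"
proof (rule ccontr)
  assume contra: "\<not> ?thesis"
  define h where "h = refine H N"
  have meshH: "is_mesh \<Omega> H" by (rule admissible_mesh[OF H])
  have meshh: "is_mesh \<Omega> h"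
    unfolding h_def using strategy meshH N by (auto simp: refinement_strategy_def)
  define C where "C = {T' \<in> h. \<exists>T\<in>H. T' \<subseteq> T}"
  have Sh: "S \<in> h" using S by (simp add: h_def)
  have "negligible (S \<inter> T')" if "T' \<in> C" for T'
  proof -
    have "T' \<in> h" "S \<noteq> T'" using that contra by (auto simp: C_def)
    then show ?thesis
      using is_meshD(6,8)[OF meshh] Sh by (simp add: negligible_iff_measure fmeasurable.Int)
  qed
  then have "negligible (\<Union>T'\<in>C. S \<inter> T')"
    using is_meshD(1)[OF meshh] by (intro negligible_Union) (auto simp: C_def)
  moreover have "S \<subseteq> \<Union>C"
  proof
    fix x assume "x \<in> S"
    then have "x \<in> \<Union>H" using is_meshD(3)[OF meshh Sh] is_meshD(5)[OF meshH] by auto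
    then obtain T where T: "T \<in> H" "x \<in> T" by blast
    then have "T = \<Union>{T' \<in> h. T' \<subseteq> T}"
      using child H N by (auto simp: child_property_def h_def)
    then obtain T' where "T' \<in> h" "T' \<subseteq> T" "x \<in> T'" using T(2) by blast
    then show "x \<in> \<Union>C" using T(1) by (auto simp: C_def)
  qed
  then have "(\<Union>T'\<in>C. S \<inter> T') = S" by blast
  ultimately have "vol S = 0" by (simp add: negligible_imp_measure0)
  then show False using is_meshD(4)[OF meshh Sh] by simp
qed

text \<open>
  The sum of the squared volumes is a potential that decreases under refinement, quantitatively in
  terms of the refined elements: the children of a refined \<open>T\<close> have volume at most
  \<open>\<rho>_child * vol T\<close> and total volume \<open>vol T\<close>.
\<close>

lemma refine_sum_squares:
  assumes H: "H \<in> admissible" and N: "N \<subseteq> H"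
  shows "(\<Sum>T\<in>refine H N. (vol T)\<^sup>2) + (1 - \<rho>_child) * (\<Sum>T\<in>H - refine H N. (vol T)\<^sup>2)
           \<le> (\<Sum>T\<in>H. (vol T)\<^sup>2)"
proof -
  define h where "h = refine H N"
  have meshH: "is_mesh \<Omega> H" by (rule admissible_mesh[OF H])
  have meshh: "is_mesh \<Omega> h"
    unfolding h_def using strategy meshH N by (auto simp: refinement_strategy_def)
  note finH = is_meshD(1)[OF meshH] and finh = is_meshD(1)[OF meshh]
  have "(\<Sum>S\<in>h. (vol S)\<^sup>2) \<le> (\<Sum>S\<in>h. \<Sum>T | T \<in> H \<and> S \<subseteq> T. (vol S)\<^sup>2)"
  proof (rule sum_mono)
    fix S assume "S \<in> h"
    then obtain T where "T \<in> H" "S \<subseteq> T" using parent_exists[OF H N] by (auto simp: h_def)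
    then show "(vol S)\<^sup>2 \<le> (\<Sum>T | T \<in> H \<and> S \<subseteq> T. (vol S)\<^sup>2)"
      using finH by (intro member_le_sum[where i = T and f = "\<lambda>_. (vol S)\<^sup>2"]) auto
  qed
  also have "\<dots> = (\<Sum>T\<in>H. \<Sum>S | S \<in> h \<and> S \<subseteq> T. (vol S)\<^sup>2)"
    using finh finH by (rule sum.swap_restrict)
  also have "\<dots> \<le> (\<Sum>T\<in>H. (vol T)\<^sup>2 - (if T \<in> H - h then (1 - \<rho>_child) * (vol T)\<^sup>2 else 0))"
  proof (rule sum_mono)
    fix T assume T: "T \<in> H"
    \<comment> \<open>the bound on the relative size of the elements of the new mesh inside \<open>T\<close>\<close>
    define q where "q = (if T \<in> H - h then \<rho>_child else 1)"
    have q: "0 \<le> q" using child_factor by (simp add: q_def)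
    have le: "vol S \<le> q * vol T" if "S \<in> h" "S \<subseteq> T" for S
    proof (cases "T \<in> h")
      case True
      have "vol S \<le> vol T"
        using that is_meshD(8)[OF meshH T] is_meshD(8)[OF meshh]
        by (intro measure_mono_fmeasurable) (auto simp: fmeasurableD)
      then show ?thesis using True by (simp add: q_def)
    next
      case False
      then have "vol S < \<rho>_child * vol T"
        using size_reduction H N T that by (auto simp: uniform_size_reduction_def h_def)
      then show ?thesis using False T by (simp add: q_def)
    qed
    have "(\<Sum>S | S \<in> h \<and> S \<subseteq> T. (vol S)\<^sup>2) \<le> (\<Sum>S | S \<in> h \<and> S \<subseteq> T. (q * vol T) * vol S)"
      using le by (intro sum_mono) (auto simp: power2_eq_square intro!: mult_right_mono)
    also have "\<dots> = (q * vol T) * sum vol {S. S \<in> h \<and> S \<subseteq> T}"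
      by (simp add: sum_distrib_left)
    also have "\<dots> \<le> (q * vol T) * vol T"
      using q is_meshD(8)[OF meshH T]
      by (intro mult_left_mono mesh_sum_vol_le[OF bounded_domain meshh]) auto
    also have "\<dots> = (vol T)\<^sup>2 - (if T \<in> H - h then (1 - \<rho>_child) * (vol T)\<^sup>2 else 0)"
      by (simp add: q_def power2_eq_square algebra_simps)
    finally show "(\<Sum>S | S \<in> h \<and> S \<subseteq> T. (vol S)\<^sup>2)
        \<le> (vol T)\<^sup>2 - (if T \<in> H - h then (1 - \<rho>_child) * (vol T)\<^sup>2 else 0)" .
  qed
  also have "\<dots> = (\<Sum>T\<in>H. (vol T)\<^sup>2) - (\<Sum>T\<in>H - h. (1 - \<rho>_child) * (vol T)\<^sup>2)"
  proof -
    have "H \<inter> (H - h) = H - h" by blast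
    then show ?thesis
      using sum.inter_restrict[OF finH, of "\<lambda>T. (1 - \<rho>_child) * (vol T)\<^sup>2" "H - h"]
      unfolding sum_subtractf by simp
  qed
  finally show ?thesis by (simp add: h_def sum_distrib_left)
qed

lemma refined_volume_vanishes:
  assumes "0 < \<delta>"
  shows "\<forall>\<^sub>F l in sequentially. \<forall>T\<in>\<T>\<^sub>l l - \<T>\<^sub>l (Suc l). vol T < \<delta>"
proof -
  define \<Phi> where "\<Phi> = (\<lambda>l. \<Sum>T\<in>\<T>\<^sub>l l. (vol T)\<^sup>2)"
  have drop: "\<Phi> (Suc l) + (1 - \<rho>_child) * (\<Sum>T\<in>\<T>\<^sub>l l - \<T>\<^sub>l (Suc l). (vol T)\<^sup>2) \<le> \<Phi> l" for l
    using refine_sum_squares[OF sequence_admissible marked, of l] by (simp add: \<Phi>_def refined)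
  have nonneg: "0 \<le> (1 - \<rho>_child) * (\<Sum>T\<in>\<T>\<^sub>l l - \<T>\<^sub>l (Suc l). (vol T)\<^sup>2)" for l
    using child_factor by (intro mult_nonneg_nonneg sum_nonneg) auto
  have "decseq \<Phi>"
    by (rule decseq_SucI) (use drop nonneg in \<open>meson add_increasing2 order_trans order_refl\<close>)
  moreover have "\<forall>l. 0 \<le> \<Phi> l" by (auto simp: \<Phi>_def intro: sum_nonneg)
  ultimately obtain c where lim: "\<Phi> \<longlonglongrightarrow> c" by (rule decseq_convergent)
  have "(\<lambda>l. \<Phi> l - \<Phi> (Suc l)) \<longlonglongrightarrow> c - c"
    using lim by (intro tendsto_diff LIMSEQ_Suc)
  then have "\<forall>\<^sub>F l in sequentially. \<Phi> l - \<Phi> (Suc l) < (1 - \<rho>_child) * \<delta>\<^sup>2"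
    using child_factor assms by (intro order_tendstoD) auto
  then show ?thesis
  proof eventually_elim
    case (elim l)
    show ?case
    proof
      fix T assume T: "T \<in> \<T>\<^sub>l l - \<T>\<^sub>l (Suc l)"
      have "(vol T)\<^sup>2 \<le> (\<Sum>T\<in>\<T>\<^sub>l l - \<T>\<^sub>l (Suc l). (vol T)\<^sup>2)"
        using T is_meshD(1)[OF sequence_mesh, of l] by (intro member_le_sum) auto
      then have "(1 - \<rho>_child) * (vol T)\<^sup>2 \<le> (1 - \<rho>_child) * (\<Sum>T\<in>\<T>\<^sub>l l - \<T>\<^sub>l (Suc l). (vol T)\<^sup>2)"
        using child_factor by (intro mult_left_mono) auto
      also have "\<dots> < (1 - \<rho>_child) * \<delta>\<^sup>2" using drop[of l] elim by linarith
      finally have "(vol T)\<^sup>2 < \<delta>\<^sup>2" using child_factor by simp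
      then show "vol T < \<delta>" using assms by (metis less_le power2_less_imp_less)
    qed
  qed
qed

text \<open>
  The elements that, from some step on, belong to all meshes.
\<close>

definition persistent :: "'a set set" where
  "persistent = {T. \<exists>m. \<forall>l\<ge>m. T \<in> \<T>\<^sub>l l}"

lemma large_elements_persistent:
  assumes "0 < \<delta>"
  shows "\<exists>L. \<forall>l\<ge>L. \<forall>T\<in>\<T>\<^sub>l l. \<delta> \<le> vol T \<longrightarrow> T \<in> persistent"
proof -
  obtain L where L: "\<And>l T. L \<le> l \<Longrightarrow> T \<in> \<T>\<^sub>l l - \<T>\<^sub>l (Suc l) \<Longrightarrow> vol T < \<delta>"
    using refined_volume_vanishes[OF assms] by (auto simp: eventually_sequentially)
  have "T \<in> persistent" if "L \<le> l" "T \<in> \<T>\<^sub>l l" "\<delta> \<le> vol T" for l T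
  proof -
    have "T \<in> \<T>\<^sub>l k" if "l \<le> k" for k
      using that
    proof (induction k rule: dec_induct)
      case (step k)
      then show ?case using L[of k T] \<open>L \<le> l\<close> \<open>\<delta> \<le> vol T\<close> by force
    qed (use \<open>T \<in> \<T>\<^sub>l l\<close> in auto)
    then show ?thesis by (auto simp: persistent_def)
  qed
  then show ?thesis by blast
qed

lemma finite_persistent_subset:
  assumes "finite F" "F \<subseteq> persistent"
  shows "\<exists>m. F \<subseteq> \<T>\<^sub>l m"
proof -
  have "\<exists>m. \<forall>l\<ge>m. F \<subseteq> \<T>\<^sub>l l"
    using assms
  proof (induction rule: finite_induct)
    case (insert T F)
    then obtain m k where "\<forall>l\<ge>m. F \<subseteq> \<T>\<^sub>l l" "\<forall>l\<ge>k. T \<in> \<T>\<^sub>l l" by (auto simp: persistent_def)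
    then show ?case by (intro exI[of _ "max m k"]) auto
  qed auto
  then show ?thesis by blast
qed

text \<open>
  The volumes of the persistent elements are summable, since finitely many of them always lie in a
  common mesh; hence the tail formed by the small ones is small.
\<close>

lemma small_persistent_sum:
  assumes "0 < \<epsilon>"
  shows "\<exists>\<delta>>0. \<forall>F. finite F \<and> F \<subseteq> persistent \<and> (\<forall>T\<in>F. vol T < \<delta>) \<longrightarrow> sum vol F \<le> \<epsilon>"
proof -
  define A where "A = sum vol ` {F. finite F \<and> F \<subseteq> persistent}"
  have "sum vol F \<le> vol (closure \<Omega>)" if F: "finite F" "F \<subseteq> persistent" for F
  proof -
    obtain m where m: "F \<subseteq> \<T>\<^sub>l m" using finite_persistent_subset[OF F] by blast
    moreover have "\<Union>F \<subseteq> closure \<Omega>" using m is_meshD(3)[OF sequence_mesh, of _ m] by blast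
    moreover have "closure \<Omega> \<in> lmeasurable"
      using bounded_domain by (simp add: lmeasurable_compact)
    ultimately show ?thesis by (intro mesh_sum_vol_le[OF bounded_domain sequence_mesh])
  qed
  then have bdd: "bdd_above A" by (intro bdd_aboveI[of _ "vol (closure \<Omega>)"]) (auto simp: A_def)
  have "A \<noteq> {}" unfolding A_def by blast
  then obtain a where "a \<in> A" "Sup A - \<epsilon> < a"
    using less_cSup_iff[OF _ bdd, of "Sup A - \<epsilon>"] assms by auto
  then obtain F\<^sub>0 where F\<^sub>0: "finite F\<^sub>0" "F\<^sub>0 \<subseteq> persistent" "Sup A - \<epsilon> < sum vol F\<^sub>0"
    by (auto simp: A_def)
  define \<delta> where "\<delta> = Min (insert 1 (vol ` F\<^sub>0))"
  \<comment> \<open>elements of volume below \<open>\<delta>\<close> are not in \<open>F\<^sub>0\<close>, whose sum is already within \<open>\<epsilon>\<close> of the supremum\<close>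
  obtain m\<^sub>0 where "F\<^sub>0 \<subseteq> \<T>\<^sub>l m\<^sub>0" using finite_persistent_subset[OF F\<^sub>0(1,2)] by blast
  then have "0 < \<delta>" using F\<^sub>0(1) is_meshD(4)[OF sequence_mesh, of _ m\<^sub>0] by (auto simp: \<delta>_def)
  moreover have "sum vol F \<le> \<epsilon>" if F: "finite F" "F \<subseteq> persistent" "\<forall>T\<in>F. vol T < \<delta>" for F
  proof -
    have "\<delta> \<le> vol T" if "T \<in> F\<^sub>0" for T using F\<^sub>0(1) that by (simp add: \<delta>_def)
    then have disj: "F \<inter> F\<^sub>0 = {}" using F(3) by force
    have "sum vol (F \<union> F\<^sub>0) \<in> A" unfolding A_def using F F\<^sub>0 by (intro image_eqI[OF refl]) simp
    then have "sum vol (F \<union> F\<^sub>0) \<le> Sup A" using bdd by (rule cSup_upper)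
    then show ?thesis using F\<^sub>0(1,3) F(1) disj by (simp add: sum.union_disjoint)
  qed
  ultimately show ?thesis by blast
qed

text \<open>
  The elements of the \<open>l\<close>-th mesh having a patch element \<open>T'\<close> that contains a persistent element of
  the \<open>m\<close>-th mesh whose volume is at least \<open>\<rho> * vol T'\<close>.
\<close>

definition near_persistent :: "real \<Rightarrow> nat \<Rightarrow> nat \<Rightarrow> 'a set set" where
  "near_persistent \<rho> l m = {T \<in> \<T>\<^sub>l l. \<exists>T'\<in>patch (\<T>\<^sub>l l) T. \<exists>S\<in>\<T>\<^sub>l m \<inter> persistent.
      S \<subseteq> T' \<and> \<rho> * vol T' \<le> vol S}"

text \<open>
  If some patch element of \<open>T\<close> still contains an insufficiently small element in a late mesh, then this
  element has a volume bounded below in terms of the \<open>l\<close>-th mesh, and late large elements are persistent.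
\<close>

lemma sufficiently_refined_or_near_persistent:
  assumes "0 < \<rho>"
  shows "\<exists>m\<ge>l. \<forall>T\<in>\<T>\<^sub>l l - near_persistent \<rho> l m.
           \<T>\<^sub>l m \<in> sufficiently_refined refine (\<T>\<^sub>l l) {T} \<rho>"
proof -
  define \<mu> where "\<mu> = Min (insert 1 (vol ` \<T>\<^sub>l l))"
  note mesh = sequence_mesh[of l]
  have "0 < \<mu>" using is_meshD(1,4)[OF mesh] by (auto simp: \<mu>_def)
  have \<mu>: "\<mu> \<le> vol T" if "T \<in> \<T>\<^sub>l l" for T using is_meshD(1)[OF mesh] that by (simp add: \<mu>_def)
  obtain L where L: "\<And>k T. L \<le> k \<Longrightarrow> T \<in> \<T>\<^sub>l k \<Longrightarrow> \<rho> * \<mu> \<le> vol T \<Longrightarrow> T \<in> persistent"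
    using large_elements_persistent[of "\<rho> * \<mu>"] assms \<open>0 < \<mu>\<close> by auto
  define m where "m = max l L"
  have "\<T>\<^sub>l m \<in> sufficiently_refined refine (\<T>\<^sub>l l) {T} \<rho>" if T: "T \<in> \<T>\<^sub>l l - near_persistent \<rho> l m" for T
  proof -
    have "vol S < \<rho> * vol T'" if "T' \<in> patch (\<T>\<^sub>l l) T" "S \<in> \<T>\<^sub>l m" "S \<subseteq> T'" for T' S
    proof (rule ccontr)
      assume "\<not> vol S < \<rho> * vol T'"
      then have S: "\<rho> * vol T' \<le> vol S" by simp
      have "\<rho> * \<mu> \<le> \<rho> * vol T'" using \<mu>[of T'] assms that(1) by (simp add: patch_def)
      then have "S \<in> persistent" using S that L[of m S] by (simp add: m_def)
      then have "T \<in> near_persistent \<rho> l m" using S that T by (auto simp: near_persistent_def)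
      then show False using T by simp
    qed
    then show ?thesis
      using sequence_refines[of l m] by (auto simp: sufficiently_refined_def m_def)
  qed
  then show ?thesis by (intro exI[of _ m]) (auto simp: m_def)
qed

text \<open>
  A persistent element lies in only one element \<open>T'\<close> of the \<open>l\<close>-th mesh, hence can be assigned only to
  the elements of the patch of \<open>T'\<close>.
\<close>

lemma near_persistent_multiplicity:
  assumes g: "\<And>T. T \<in> B \<Longrightarrow> T \<in> \<T>\<^sub>l l \<and> g T \<in> \<T>\<^sub>l m \<and> (\<exists>T'\<in>patch (\<T>\<^sub>l l) T. g T \<subseteq> T')"
  shows "real (card {T \<in> B. g T = S}) \<le> C_patch"
proof (cases "{T \<in> B. g T = S} = {}")
  case False
  then obtain T\<^sub>0 where T\<^sub>0: "T\<^sub>0 \<in> B" "g T\<^sub>0 = S" by blast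
  then obtain T' where T': "T' \<in> patch (\<T>\<^sub>l l) T\<^sub>0" "S \<subseteq> T'" and S: "S \<in> \<T>\<^sub>l m" using g by blast
  have T'l: "T' \<in> \<T>\<^sub>l l" using T'(1) by (simp add: patch_def)
  have "{T \<in> B. g T = S} \<subseteq> patch (\<T>\<^sub>l l) T'"
  proof safe
    fix T assume T: "T \<in> B" "S = g T"
    then obtain T'' where T'': "T'' \<in> patch (\<T>\<^sub>l l) T" "S \<subseteq> T''" using g by blast
    then have "T'' \<in> \<T>\<^sub>l l" by (simp add: patch_def)
    then have "T'' = T'"
      using mesh_element_unique[OF sequence_mesh _ T'l T''(2) T'(2)] is_meshD(4,8)[OF sequence_mesh S]
      by blast
    then show "T \<in> patch (\<T>\<^sub>l l) T'"
      using patch_sym[OF sequence_mesh, of T l T''] T'' T(1) g by blast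
  qed
  then have "card {T \<in> B. g T = S} \<le> card (patch (\<T>\<^sub>l l) T')"
    using is_meshD(1)[OF sequence_mesh, of l] by (intro card_mono) (auto simp: patch_def)
  then show ?thesis using card_patch[OF sequence_admissible T'l] by simp
next
  case True
  then have "card {T \<in> B. g T = S} = 0" by (metis card.empty)
  then show ?thesis using constants by linarith
qed

lemma near_persistent_sum:
  assumes \<rho>: "0 < \<rho>" and \<delta>: "\<And>F. finite F \<Longrightarrow> F \<subseteq> persistent \<Longrightarrow> (\<And>T. T \<in> F \<Longrightarrow> vol T < \<delta>) \<Longrightarrow> sum vol F \<le> \<epsilon>"
    and B: "B \<subseteq> near_persistent \<rho> l m" "\<And>T. T \<in> B \<Longrightarrow> C_size * vol T < \<delta>"
  shows "sum vol B \<le> C_size / \<rho> * C_patch * \<epsilon>"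
proof -
  have "\<exists>S. \<exists>T'. T \<in> \<T>\<^sub>l l \<and> T' \<in> patch (\<T>\<^sub>l l) T \<and> S \<in> \<T>\<^sub>l m \<inter> persistent \<and>
      S \<subseteq> T' \<and> \<rho> * vol T' \<le> vol S" if "T \<in> B" for T
    using that B(1) unfolding near_persistent_def by blast
  then obtain g where g: "\<And>T. T \<in> B \<Longrightarrow> \<exists>T'. T \<in> \<T>\<^sub>l l \<and> T' \<in> patch (\<T>\<^sub>l l) T \<and>
      g T \<in> \<T>\<^sub>l m \<inter> persistent \<and> g T \<subseteq> T' \<and> \<rho> * vol T' \<le> vol (g T)"
    by metis
  have finB: "finite B"
    using B is_meshD(1)[OF sequence_mesh, of l] by (auto simp: near_persistent_def intro: rev_finite_subset)
  have le: "vol T \<le> C_size / \<rho> * vol (g T) \<and> vol (g T) < \<delta>" if "T \<in> B" for T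
  proof -
    obtain T' where T': "T \<in> \<T>\<^sub>l l" "T' \<in> patch (\<T>\<^sub>l l) T" "g T \<in> \<T>\<^sub>l m" "g T \<subseteq> T'"
      "\<rho> * vol T' \<le> vol (g T)" using g[OF \<open>T \<in> B\<close>] by blast
    have "T' \<in> \<T>\<^sub>l l" using T'(2) by (simp add: patch_def)
    then have "vol (g T) \<le> vol T'"
      using T'(3,4) is_meshD(8)[OF sequence_mesh] by (intro measure_mono_fmeasurable) (auto simp: fmeasurableD)
    also have "\<dots> \<le> C_size * vol T" by (rule vol_patch'[OF sequence_admissible T'(1,2)])
    also have "\<dots> < \<delta>" using B(2) that by blast
    finally have "vol (g T) < \<delta>" .
    have "vol T \<le> C_size * vol T'" by (rule vol_patch[OF sequence_admissible T'(1,2)])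
    also have "\<dots> \<le> C_size * (vol (g T) / \<rho>)"
      using constants \<rho> T'(5) by (intro mult_left_mono) (auto simp: field_simps)
    finally show ?thesis using \<open>vol (g T) < \<delta>\<close> by simp
  qed
  have "sum vol B \<le> (\<Sum>T\<in>B. C_size / \<rho> * vol (g T))" using le by (intro sum_mono) blast
  also have "\<dots> = C_size / \<rho> * (\<Sum>T\<in>B. vol (g T))" by (simp add: sum_distrib_left)
  also have "(\<Sum>T\<in>B. vol (g T)) = (\<Sum>S\<in>g ` B. real (card {T \<in> B. g T = S}) * vol S)"
    using finB by (intro sum_fun_comp) auto
  also have "\<dots> \<le> (\<Sum>S\<in>g ` B. C_patch * vol S)"
  proof (intro sum_mono mult_right_mono near_persistent_multiplicity)
    show "T \<in> \<T>\<^sub>l l \<and> g T \<in> \<T>\<^sub>l m \<and> (\<exists>T'\<in>patch (\<T>\<^sub>l l) T. g T \<subseteq> T')" if "T \<in> B" for T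
      using g[OF that] by blast
  qed auto
  also have "\<dots> = C_patch * sum vol (g ` B)" by (simp add: sum_distrib_left)
  also have "\<dots> \<le> C_patch * \<epsilon>"
  proof (intro mult_left_mono \<delta>)
    show "g ` B \<subseteq> persistent" using g by blast
  qed (use finB le constants in auto)
  finally show ?thesis using constants \<rho> by (simp add: mult_left_mono divide_right_mono mult.assoc)
qed

lemma vol_union_patches:
  assumes H: "H \<in> admissible" and B: "B \<subseteq> H"
  shows "vol (\<Union>T\<in>B. patch_region H T) \<le> C_patch * C_size * sum vol B"
proof -
  have mesh: "is_mesh \<Omega> H" by (rule admissible_mesh[OF H])
  have finB: "finite B" using is_meshD(1)[OF mesh] B finite_subset by blast
  have fp: "finite (patch H T)" for T using is_meshD(1)[OF mesh] by (simp add: patch_def)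
  have "vol (\<Union>T\<in>B. patch_region H T) \<le> (\<Sum>T\<in>B. vol (patch_region H T))"
    using finB patch_region_parts[OF mesh] by (intro measure_UNION_le) (auto simp: measurable_parts_def)
  also have "\<dots> \<le> (\<Sum>T\<in>B. C_patch * C_size * vol T)"
  proof (rule sum_mono)
    fix T assume "T \<in> B"
    then have T: "T \<in> H" using B by auto
    have "vol (patch_region H T) \<le> sum vol (patch H T)"
      unfolding patch_region_def using fp is_meshD(8)[OF mesh]
      by (intro measure_Union_le) (auto simp: patch_def fmeasurableD)
    also have "\<dots> \<le> real (card (patch H T)) * (C_size * vol T)"
      using vol_patch'[OF H T] by (intro sum_bounded_above)
    also have "\<dots> \<le> C_patch * (C_size * vol T)"
      using card_patch[OF H T] constants by (intro mult_right_mono) auto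
    finally show "vol (patch_region H T) \<le> C_patch * C_size * vol T" by (simp add: mult.assoc)
  qed
  finally show ?thesis by (simp add: sum_distrib_left)
qed

text \<open>
  Uniformly in \<open>l\<close> and \<open>m\<close>, small elements near comparable persistent ones cover a small region, as the
  persistent elements concerned are themselves small.
\<close>

lemma near_persistent_region_small:
  assumes \<rho>: "0 < \<rho>" and \<epsilon>: "0 < \<epsilon>"
  shows "\<exists>c>0. \<forall>l m B. B \<subseteq> near_persistent \<rho> l m \<and> (\<forall>T\<in>B. vol T < c) \<longrightarrow>
           vol (\<Union>T\<in>B. patch_region (\<T>\<^sub>l l) T) \<le> \<epsilon>"
proof -
  define K where "K = C_patch * C_size * (C_size / \<rho> * C_patch)"
  have K: "0 < K" using constants \<rho> by (simp add: K_def)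
  obtain \<delta> where \<delta>: "\<delta> > 0"
    "\<forall>F. finite F \<and> F \<subseteq> persistent \<and> (\<forall>T\<in>F. vol T < \<delta>) \<longrightarrow> sum vol F \<le> \<epsilon> / K"
    using small_persistent_sum[of "\<epsilon> / K"] \<epsilon> K by auto
  have "vol (\<Union>T\<in>B. patch_region (\<T>\<^sub>l l) T) \<le> \<epsilon>"
    if B: "B \<subseteq> near_persistent \<rho> l m" "\<forall>T\<in>B. vol T < \<delta> / C_size" for l m B
  proof -
    have "vol (\<Union>T\<in>B. patch_region (\<T>\<^sub>l l) T) \<le> C_patch * C_size * sum vol B"
      using B by (intro vol_union_patches[OF sequence_admissible]) (auto simp: near_persistent_def)
    also have "sum vol B \<le> C_size / \<rho> * C_patch * (\<epsilon> / K)"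
    proof (rule near_persistent_sum[OF \<rho> _ B(1)])
      show "C_size * vol T < \<delta>" if "T \<in> B" for T
        using B(2) that constants by (auto simp: field_simps)
    qed (use \<delta>(2) in blast)
    also have "C_patch * C_size * (C_size / \<rho> * C_patch * (\<epsilon> / K)) = K * (\<epsilon> / K)"
      by (simp add: K_def)
    also have "\<dots> = \<epsilon>" using K by simp
    finally show ?thesis using constants by (simp add: mult_left_mono)
  qed
  then show ?thesis using \<delta>(1) constants by (intro exI[of _ "\<delta> / C_size"]) auto
qed

end

section \<open>The contribution of small elements to the estimator\<close>

text \<open>
  One of the two problems, primal or dual: \<open>v\<close> is the discrete solution, \<open>\<xi>\<close> the refinement indicator,
  \<open>v_exact\<close> the exact solution and \<open>v_inf\<close> the limit along the
  algorithm. The two limits may differ.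
\<close>

locale adaptive_estimator = adaptive_meshes +
  fixes snX :: "'a set \<Rightarrow> 'x::real_normed_vector \<Rightarrow> real"
    and snD :: "'a set \<Rightarrow> 'd::real_normed_vector \<Rightarrow> real"
    and v :: "'a mesh \<Rightarrow> 'x" and \<xi> :: "'a mesh \<Rightarrow> 'a set \<Rightarrow> real"
    and osc :: "'a mesh \<Rightarrow> 'a set set \<Rightarrow> real" and D :: 'd
    and w :: "real \<Rightarrow> real" and \<rho>_deff C_deff :: real and v_exact v_inf :: 'x
  assumes snX: "seminorm_family \<Omega> snX" "subadditive_family \<Omega> snX"
      "abs_continuous_family \<Omega> snX" "approximates_natural_norm \<Omega> snX"
    and snD: "seminorm_family \<Omega> snD" "subadditive_family \<Omega> snD" "approximates_natural_norm \<Omega> snD"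
    and efficiency_constants: "0 < \<rho>_deff" "1 \<le> C_deff"
    and efficiency: "local_discrete_efficiency (refinements refine H\<^sub>0) refine snX \<rho>_deff C_deff v \<xi> osc"
    and weight: "oscillation_weight w"
    and oscillation: "oscillation_bounded (refinements refine H\<^sub>0) snX snD w v D osc"
    and approximation: "\<And>\<epsilon> H. 0 < \<epsilon> \<Longrightarrow> H \<in> refinements refine H\<^sub>0 \<Longrightarrow>
          \<exists>h\<in>sufficiently_refined refine H H \<rho>_deff. norm (v_exact - v h) \<le> \<epsilon>"
    and convergence: "(\<lambda>l. norm (v_inf - v (\<T>\<^sub>l l))) \<longlonglongrightarrow> 0"
begin

lemma union_patches_part:
  assumes "H \<in> admissible" "U \<subseteq> H"
  shows "(\<Union>T\<in>U. patch_region H T) \<in> measurable_parts \<Omega>"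
proof -
  note mesh = admissible_mesh[OF assms(1)]
  show ?thesis
    using finite_subset[OF assms(2) is_meshD(1)[OF mesh]] patch_region_parts[OF mesh]
    by (intro measurable_parts_Union) auto
qed

lemma indicators_le_patch_seminorms:
  assumes H: "H \<in> admissible" and U: "U \<subseteq> H"
    and h: "\<And>T. T \<in> U \<Longrightarrow> h \<in> sufficiently_refined refine H {T} \<rho>_deff"
    and t: "\<And>T. T \<in> U \<Longrightarrow> vol T \<le> t" "0 \<le> t"
  shows "(\<Sum>T\<in>U. (\<xi> H T)\<^sup>2) \<le> C_deff\<^sup>2 * C_patch\<^sup>2 *
           ((snX (\<Union>T\<in>U. patch_region H T) (v h - v H))\<^sup>2 + w t * ((norm (v H))\<^sup>2 + (norm D)\<^sup>2))"
proof -
  have mesh: "is_mesh \<Omega> H" by (rule admissible_mesh[OF H])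
  have Cp: "0 \<le> C_patch" using constants by simp
  have wt: "0 \<le> w t" using weight t(2) by (simp add: oscillation_weight_def)
  note part = union_patches_part[OF H U]
  note sumX = sum_patch_seminorms[OF bounded_domain mesh U snX(2,1) card_patch[OF H] Cp]
  note sumD = sum_patch_seminorms[OF bounded_domain mesh U snD(2,1) card_patch[OF H] Cp]
  have eff: "(\<xi> H T)\<^sup>2 \<le> C_deff\<^sup>2 * ((snX (patch_region H T) (v h - v H))\<^sup>2 +
      w t * ((snX (patch_region H T) (v H))\<^sup>2 + (snD (patch_region H T) D)\<^sup>2))" if T: "T \<in> U" for T
  proof -
    have TH: "T \<in> H" using T U by blast
    have "w (vol T) \<le> w t"
      using weight t(1)[OF T] t(2)
      by (intro mono_onD[of "{0..}" w]) (simp_all add: oscillation_weight_def)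
    then have "w (vol T) * ((snX (patch_region H T) (v H))\<^sup>2 + (snD (patch_region H T) D)\<^sup>2)
        \<le> w t * ((snX (patch_region H T) (v H))\<^sup>2 + (snD (patch_region H T) D)\<^sup>2)"
      by (intro mult_right_mono) auto
    moreover have "(osc H (patch H T))\<^sup>2
        \<le> w (vol T) * ((snX (patch_region H T) (v H))\<^sup>2 + (snD (patch_region H T) D)\<^sup>2)"
      using oscillation H TH by (auto simp: oscillation_bounded_def)
    moreover have "(\<xi> H T)\<^sup>2 / C_deff\<^sup>2
        \<le> (snX (patch_region H T) (v h - v H))\<^sup>2 + (osc H (patch H T))\<^sup>2"
      using efficiency H TH h[OF T] unfolding local_discrete_efficiency_def by blast
    ultimately have "(\<xi> H T)\<^sup>2 / C_deff\<^sup>2 \<le> (snX (patch_region H T) (v h - v H))\<^sup>2 +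
        w t * ((snX (patch_region H T) (v H))\<^sup>2 + (snD (patch_region H T) D)\<^sup>2)"
      by linarith
    moreover have "0 < C_deff\<^sup>2" using efficiency_constants by simp
    ultimately show ?thesis by (simp add: pos_divide_le_eq mult.commute)
  qed
  have "(\<Sum>T\<in>U. (\<xi> H T)\<^sup>2) \<le> (\<Sum>T\<in>U. C_deff\<^sup>2 * ((snX (patch_region H T) (v h - v H))\<^sup>2 +
      w t * ((snX (patch_region H T) (v H))\<^sup>2 + (snD (patch_region H T) D)\<^sup>2)))"
    by (rule sum_mono[OF eff])
  also have "\<dots> = C_deff\<^sup>2 * ((\<Sum>T\<in>U. (snX (patch_region H T) (v h - v H))\<^sup>2) +
      w t * ((\<Sum>T\<in>U. (snX (patch_region H T) (v H))\<^sup>2) + (\<Sum>T\<in>U. (snD (patch_region H T) D)\<^sup>2)))"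
    by (simp only: sum_distrib_left[symmetric] sum.distrib)
  also have "\<dots> \<le> C_deff\<^sup>2 * (C_patch\<^sup>2 * (snX (\<Union>T\<in>U. patch_region H T) (v h - v H))\<^sup>2 +
      w t * (C_patch\<^sup>2 * (norm (v H))\<^sup>2 + C_patch\<^sup>2 * (norm D)\<^sup>2))"
  proof (intro mult_left_mono add_mono sumX)
    have "(snX (\<Union>T\<in>U. patch_region H T) (v H))\<^sup>2 \<le> (norm (v H))\<^sup>2"
      using subadditive_family_le_norm[OF snX(1,2,4) part] seminorm_family_nonneg[OF snX(1) part]
      by (intro power_mono)
    then have "C_patch\<^sup>2 * (snX (\<Union>T\<in>U. patch_region H T) (v H))\<^sup>2 \<le> C_patch\<^sup>2 * (norm (v H))\<^sup>2"
      by (intro mult_left_mono) auto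
    then show "(\<Sum>T\<in>U. (snX (patch_region H T) (v H))\<^sup>2) \<le> C_patch\<^sup>2 * (norm (v H))\<^sup>2"
      using sumX[of "v H"] by simp
    have "(snD (\<Union>T\<in>U. patch_region H T) D)\<^sup>2 \<le> (norm D)\<^sup>2"
      using subadditive_family_le_norm[OF snD part] seminorm_family_nonneg[OF snD(1) part]
      by (intro power_mono)
    then have "C_patch\<^sup>2 * (snD (\<Union>T\<in>U. patch_region H T) D)\<^sup>2 \<le> C_patch\<^sup>2 * (norm D)\<^sup>2"
      by (intro mult_left_mono) auto
    then show "(\<Sum>T\<in>U. (snD (patch_region H T) D)\<^sup>2) \<le> C_patch\<^sup>2 * (norm D)\<^sup>2"
      using sumD[of D] by simp
  qed (use wt in auto)
  also have "\<dots> = C_deff\<^sup>2 * C_patch\<^sup>2 *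
      ((snX (\<Union>T\<in>U. patch_region H T) (v h - v H))\<^sup>2 + w t * ((norm (v H))\<^sup>2 + (norm D)\<^sup>2))"
    by (simp add: algebra_simps)
  finally show ?thesis .
qed

lemma discrete_solutions_bounded: "\<exists>N\<ge>0. \<forall>l. norm (v (\<T>\<^sub>l l)) \<le> N"
proof -
  obtain b where b: "\<And>l. norm (norm (v_inf - v (\<T>\<^sub>l l))) \<le> b"
    using convergent_imp_Bseq[OF convergentI[OF convergence]] by (auto simp: Bseq_def)
  have "0 \<le> b" by (rule order_trans[OF norm_ge_zero b])
  have "norm (v (\<T>\<^sub>l l)) \<le> norm v_inf + b" for l
    using norm_triangle_ineq4[of v_inf "v_inf - v (\<T>\<^sub>l l)"] b[of l] by simp
  moreover have "0 \<le> norm v_inf + b" using \<open>0 \<le> b\<close> by simp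
  ultimately show ?thesis by blast
qed

lemma sufficiently_refined_single:
  "h \<in> sufficiently_refined refine H H \<rho>_deff \<Longrightarrow> T \<in> H \<Longrightarrow> h \<in> sufficiently_refined refine H {T} \<rho>_deff"
  by (auto simp: sufficiently_refined_def)

text \<open>
  The natural approximation property for a single tolerance, here \<open>1\<close>, suffices.
\<close>

lemma estimator_bounded: "\<exists>C. \<forall>l. estimator \<xi> (\<T>\<^sub>l l) (\<T>\<^sub>l l) \<le> C"
proof -
  obtain N where N: "0 \<le> N" "\<And>l. norm (v (\<T>\<^sub>l l)) \<le> N" using discrete_solutions_bounded by blast
  define t where "t = vol (closure \<Omega>)"
  have "(\<Sum>T\<in>\<T>\<^sub>l l. (\<xi> (\<T>\<^sub>l l) T)\<^sup>2) \<le> C_deff\<^sup>2 * C_patch\<^sup>2 *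
      ((1 + norm v_exact + N)\<^sup>2 + w t * (N\<^sup>2 + (norm D)\<^sup>2))" for l
  proof -
    let ?H = "\<T>\<^sub>l l"
    obtain h where h: "h \<in> sufficiently_refined refine ?H ?H \<rho>_deff" "norm (v_exact - v h) \<le> 1"
      using approximation[of 1 ?H] sequence_admissible[of l] by auto
    have t: "vol T \<le> t" if "T \<in> ?H" for T
      unfolding t_def using is_meshD(3,8)[OF sequence_mesh that] bounded_domain
      by (intro measure_mono_fmeasurable) (simp_all add: lmeasurable_compact fmeasurableD)
    have wt: "0 \<le> w t" using weight by (simp add: oscillation_weight_def t_def)
    note part = union_patches_part[OF sequence_admissible order_refl, of l]
    have "norm (v h) \<le> 1 + norm v_exact"
      using norm_triangle_ineq4[of v_exact "v_exact - v h"] h(2) by simp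
    then have "norm (v h - v ?H) \<le> 1 + norm v_exact + N"
      using norm_triangle_ineq4[of "v h" "v ?H"] N(2)[of l] by linarith
    then have "snX (\<Union>T\<in>?H. patch_region ?H T) (v h - v ?H) \<le> 1 + norm v_exact + N"
      using subadditive_family_le_norm[OF snX(1,2,4) part] order_trans by blast
    then have "(snX (\<Union>T\<in>?H. patch_region ?H T) (v h - v ?H))\<^sup>2 \<le> (1 + norm v_exact + N)\<^sup>2"
      using seminorm_family_nonneg[OF snX(1) part] by (intro power_mono)
    moreover have "w t * ((norm (v ?H))\<^sup>2 + (norm D)\<^sup>2) \<le> w t * (N\<^sup>2 + (norm D)\<^sup>2)"
      using wt N(2)[of l] by (intro mult_left_mono add_mono power_mono) auto
    ultimately have "(snX (\<Union>T\<in>?H. patch_region ?H T) (v h - v ?H))\<^sup>2 + w t * ((norm (v ?H))\<^sup>2 + (norm D)\<^sup>2)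
        \<le> (1 + norm v_exact + N)\<^sup>2 + w t * (N\<^sup>2 + (norm D)\<^sup>2)" by linarith
    then have "C_deff\<^sup>2 * C_patch\<^sup>2 * ((snX (\<Union>T\<in>?H. patch_region ?H T) (v h - v ?H))\<^sup>2 +
        w t * ((norm (v ?H))\<^sup>2 + (norm D)\<^sup>2))
        \<le> C_deff\<^sup>2 * C_patch\<^sup>2 * ((1 + norm v_exact + N)\<^sup>2 + w t * (N\<^sup>2 + (norm D)\<^sup>2))"
      by (intro mult_left_mono) auto
    moreover have "(\<Sum>T\<in>?H. (\<xi> ?H T)\<^sup>2) \<le> C_deff\<^sup>2 * C_patch\<^sup>2 *
        ((snX (\<Union>T\<in>?H. patch_region ?H T) (v h - v ?H))\<^sup>2 + w t * ((norm (v ?H))\<^sup>2 + (norm D)\<^sup>2))"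
      using t h(1)
      by (intro indicators_le_patch_seminorms sequence_admissible sufficiently_refined_single)
        (auto simp: t_def)
    ultimately show ?thesis by linarith
  qed
  then show ?thesis unfolding estimator_def by (meson real_sqrt_le_mono)
qed

text \<open>
  A small element is either sufficiently refined later on by the algorithm itself, in which case
  local discrete efficiency bounds its indicator by a Cauchy difference, or it is near a persistent
  element. The latter elements cover a region of small volume; local discrete efficiency is
  applied to a mesh from the natural approximation property, and the possibly nonzero difference of
  \<open>v_exact\<close> and \<open>v_inf\<close> is small on that region by absolute continuity. The oscillation terms are small
  because of the factor \<open>w c\<close>.
\<close>

lemma small_elements_indicators:
  assumes "0 < \<epsilon>"
  shows "\<exists>c>0. \<forall>\<^sub>F l in sequentially. (\<Sum>T | T \<in> \<T>\<^sub>l l \<and> vol T < c. (\<xi> (\<T>\<^sub>l l) T)\<^sup>2) \<le> \<epsilon>"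
proof -
  obtain N where N: "0 \<le> N" "\<And>l. norm (v (\<T>\<^sub>l l)) \<le> N" using discrete_solutions_bounded by blast
  define K where "K = C_deff\<^sup>2 * C_patch\<^sup>2"
  define A where "A = N\<^sup>2 + (norm D)\<^sup>2"
  have K: "0 < K" using efficiency_constants constants by (simp add: K_def)
  have A: "0 \<le> A" by (simp add: A_def)
  \<comment> \<open>the Cauchy part contributes \<open>K * a\<^sup>2\<close>, the part near persistent elements \<open>K * (3 * a)\<^sup>2\<close>, and the
    oscillations \<open>K * (b * A)\<close> each\<close>
  define a where "a = sqrt (\<epsilon> / (20 * K))"
  have a: "0 < a" "K * (10 * a\<^sup>2) = \<epsilon> / 2" using assms K by (simp_all add: a_def)
  define b where "b = \<epsilon> / (4 * K * (A + 1))"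
  have b: "0 < b" using assms K A by (simp add: b_def)
  have bA: "2 * K * (b * A) \<le> \<epsilon> / 2"
  proof -
    have "2 * K * (b * A) \<le> 2 * K * (b * (A + 1))"
      using K b by (intro mult_left_mono) auto
    also have "\<dots> = \<epsilon> / 2" using K A nonzero_eq_divide_eq[of "A + 1"] by (simp add: b_def)
    finally show ?thesis .
  qed
  have "(w \<longlongrightarrow> 0) (at 0 within {0..})"
    using weight unfolding oscillation_weight_def continuous_within by metis
  then have "\<forall>\<^sub>F x in at 0 within {0..}. w x < b" using b by (rule order_tendstoD)
  then obtain d where d: "0 < d" "\<And>x. 0 \<le> x \<Longrightarrow> x \<noteq> 0 \<Longrightarrow> dist x 0 < d \<Longrightarrow> w x < b"
    by (auto simp: eventually_at)
  obtain \<delta> where \<delta>: "0 < \<delta>"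
    "\<And>\<omega>. \<omega> \<in> measurable_parts \<Omega> \<Longrightarrow> vol \<omega> < \<delta> \<Longrightarrow> snX \<omega> (v_exact - v_inf) < a"
    using snX(3) a(1) unfolding abs_continuous_family_def by meson
  obtain c\<^sub>0 where c\<^sub>0: "0 < c\<^sub>0" "\<And>l m B. B \<subseteq> near_persistent \<rho>_deff l m \<Longrightarrow> \<forall>T\<in>B. vol T < c\<^sub>0 \<Longrightarrow>
      vol (\<Union>T\<in>B. patch_region (\<T>\<^sub>l l) T) \<le> \<delta> / 2"
    using near_persistent_region_small[OF efficiency_constants(1), of "\<delta> / 2"] \<delta>(1) by auto
  define c where "c = min c\<^sub>0 (d / 2)"
  have c: "0 < c" using c\<^sub>0 d by (simp add: c_def)
  have "c < d" using d(1) by (simp add: c_def min_less_iff_disj)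
  then have wc: "0 \<le> w c" "w c \<le> b"
    using weight c less_imp_le[OF d(2)[of c]] by (simp_all add: oscillation_weight_def)
  have "\<forall>\<^sub>F l in sequentially. norm (v_inf - v (\<T>\<^sub>l l)) < a / 2"
    using convergence a(1) by (intro order_tendstoD) auto
  then obtain L where L: "\<And>l. L \<le> l \<Longrightarrow> norm (v_inf - v (\<T>\<^sub>l l)) < a / 2"
    by (auto simp: eventually_sequentially)
  have "(\<Sum>T | T \<in> \<T>\<^sub>l l \<and> vol T < c. (\<xi> (\<T>\<^sub>l l) T)\<^sup>2) \<le> \<epsilon>" if l: "L \<le> l" for l
  proof -
    let ?H = "\<T>\<^sub>l l"
    obtain m where m: "l \<le> m" "\<And>T. T \<in> ?H - near_persistent \<rho>_deff l m \<Longrightarrow>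
        \<T>\<^sub>l m \<in> sufficiently_refined refine ?H {T} \<rho>_deff"
      using sufficiently_refined_or_near_persistent[OF efficiency_constants(1), of l] by blast
    obtain h where h: "h \<in> sufficiently_refined refine ?H ?H \<rho>_deff" "norm (v_exact - v h) \<le> a"
      using approximation[of a ?H] sequence_admissible[of l] a(1) by auto
    define R where "R = {T. T \<in> ?H \<and> vol T < c}"
    define B where "B = R \<inter> near_persistent \<rho>_deff l m"
    have RH: "R - B \<subseteq> ?H" "B \<subseteq> ?H" by (auto simp: R_def B_def)
    have finR: "finite R" using is_meshD(1)[OF sequence_mesh, of l] by (simp add: R_def)
    have tail: "w c * ((norm (v ?H))\<^sup>2 + (norm D)\<^sup>2) \<le> b * A"
      unfolding A_def using wc b N(2)[of l] by (intro mult_mono add_mono power_mono) auto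
    have sum_le: "(\<Sum>T\<in>U. (\<xi> ?H T)\<^sup>2) \<le> K * (s\<^sup>2 + b * A)"
      if U: "U \<subseteq> R" and g: "\<And>T. T \<in> U \<Longrightarrow> g \<in> sufficiently_refined refine ?H {T} \<rho>_deff"
        and s: "snX (\<Union>T\<in>U. patch_region ?H T) (v g - v ?H) \<le> s" for U g s
    proof -
      have UH: "U \<subseteq> ?H" using U by (auto simp: R_def)
      have "(snX (\<Union>T\<in>U. patch_region ?H T) (v g - v ?H))\<^sup>2 \<le> s\<^sup>2"
        using s seminorm_family_nonneg[OF snX(1) union_patches_part[OF sequence_admissible UH]]
        by (intro power_mono)
      then have "K * ((snX (\<Union>T\<in>U. patch_region ?H T) (v g - v ?H))\<^sup>2 +
          w c * ((norm (v ?H))\<^sup>2 + (norm D)\<^sup>2)) \<le> K * (s\<^sup>2 + b * A)"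
        using tail K by (intro mult_left_mono add_mono) auto
      moreover have "(\<Sum>T\<in>U. (\<xi> ?H T)\<^sup>2) \<le> K * ((snX (\<Union>T\<in>U. patch_region ?H T) (v g - v ?H))\<^sup>2 +
          w c * ((norm (v ?H))\<^sup>2 + (norm D)\<^sup>2))"
        unfolding K_def using U c
        by (intro indicators_le_patch_seminorms sequence_admissible UH g) (auto simp: R_def)
      ultimately show ?thesis by linarith
    qed
    have good: "(\<Sum>T\<in>R - B. (\<xi> ?H T)\<^sup>2) \<le> K * (a\<^sup>2 + b * A)"
    proof (rule sum_le)
      show "\<T>\<^sub>l m \<in> sufficiently_refined refine ?H {T} \<rho>_deff" if "T \<in> R - B" for T
        using that m(2)[of T] by (auto simp: R_def B_def)
      have "norm (v (\<T>\<^sub>l m) - v ?H) = norm ((v_inf - v ?H) - (v_inf - v (\<T>\<^sub>l m)))" by simp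
      also have "\<dots> \<le> a / 2 + a / 2"
        using norm_triangle_ineq4[of "v_inf - v ?H" "v_inf - v (\<T>\<^sub>l m)"] L[of l] L[of m] l m(1) by linarith
      finally have "norm (v (\<T>\<^sub>l m) - v ?H) \<le> a" by simp
      then show "snX (\<Union>T\<in>R - B. patch_region ?H T) (v (\<T>\<^sub>l m) - v ?H) \<le> a"
        using subadditive_family_le_norm[OF snX(1,2,4) union_patches_part[OF sequence_admissible RH(1)]]
          order_trans by blast
    qed simp
    have bad: "(\<Sum>T\<in>B. (\<xi> ?H T)\<^sup>2) \<le> K * ((3 * a)\<^sup>2 + b * A)"
    proof (rule sum_le)
      show "h \<in> sufficiently_refined refine ?H {T} \<rho>_deff" if "T \<in> B" for T
        using that RH(2) h(1) sufficiently_refined_single by blast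
      let ?U = "\<Union>T\<in>B. patch_region ?H T"
      note part = union_patches_part[OF sequence_admissible RH(2)]
      have "vol ?U \<le> \<delta> / 2"
        by (rule c\<^sub>0(2)[of _ l m]) (auto simp: B_def R_def c_def)
      then have "snX ?U (v_exact - v_inf) < a" using \<delta> part by auto
      moreover have "snX ?U (v h - v_exact) \<le> a"
        using subadditive_family_le_norm[OF snX(1,2,4) part, of "v h - v_exact"] h(2)
        by (simp add: norm_minus_commute)
      moreover have "snX ?U (v_inf - v ?H) \<le> a"
        using subadditive_family_le_norm[OF snX(1,2,4) part, of "v_inf - v ?H"] L[OF l] a(1) by linarith
      moreover have "snX ?U (((v h - v_exact) + (v_exact - v_inf)) + (v_inf - v ?H))
          \<le> snX ?U (v h - v_exact) + snX ?U (v_exact - v_inf) + snX ?U (v_inf - v ?H)"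
        by (meson add_right_mono order_trans seminorm_family_triangle[OF snX(1) part])
      moreover have "((v h - v_exact) + (v_exact - v_inf)) + (v_inf - v ?H) = v h - v ?H" by simp
      ultimately show "snX ?U (v h - v ?H) \<le> 3 * a" by simp
    qed (simp add: B_def)
    have "(\<Sum>T\<in>R. (\<xi> ?H T)\<^sup>2) = (\<Sum>T\<in>R - B. (\<xi> ?H T)\<^sup>2) + (\<Sum>T\<in>B. (\<xi> ?H T)\<^sup>2)"
      using finR by (intro sum.subset_diff) (auto simp: B_def)
    also have "\<dots> \<le> K * (a\<^sup>2 + b * A) + K * ((3 * a)\<^sup>2 + b * A)" using good bad by simp
    also have "\<dots> = K * (10 * a\<^sup>2) + 2 * K * (b * A)" by (simp add: algebra_simps power_mult_distrib)
    also have "\<dots> \<le> \<epsilon>" using a(2) bA by simp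
    finally show ?thesis by (simp add: R_def)
  qed
  then show ?thesis using c by (auto simp: eventually_sequentially)
qed

lemma small_elements_estimator:
  assumes "0 < \<epsilon>"
  shows "\<exists>c>0. \<forall>\<^sub>F l in sequentially. estimator \<xi> (\<T>\<^sub>l l) {T \<in> \<T>\<^sub>l l. vol T < c} \<le> \<epsilon>"
proof -
  obtain c where "0 < c" and c: "\<forall>\<^sub>F l in sequentially. (\<Sum>T | T \<in> \<T>\<^sub>l l \<and> vol T < c. (\<xi> (\<T>\<^sub>l l) T)\<^sup>2) \<le> \<epsilon>\<^sup>2"
    using small_elements_indicators[of "\<epsilon>\<^sup>2"] assms by auto
  from c have "\<forall>\<^sub>F l in sequentially. estimator \<xi> (\<T>\<^sub>l l) {T \<in> \<T>\<^sub>l l. vol T < c} \<le> \<epsilon>"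
    by eventually_elim (use assms in \<open>auto simp: estimator_def intro: real_le_lsqrt sum_nonneg\<close>)
  then show ?thesis using \<open>0 < c\<close> by blast
qed

end

section \<open>Marking\<close>

lemma estimator_nonneg: "0 \<le> estimator \<xi> H U"
  by (simp add: estimator_def sum_nonneg)

lemma estimator_mono: "finite U' \<Longrightarrow> U \<subseteq> U' \<Longrightarrow> estimator \<xi> H U \<le> estimator \<xi> H U'"
  unfolding estimator_def by (intro real_sqrt_le_mono sum_mono2) auto

lemma estimator_Un_le:
  assumes "finite U" "finite U'" "U \<inter> U' = {}"
  shows "estimator \<xi> H (U \<union> U') \<le> estimator \<xi> H U + estimator \<xi> H U'"
  unfolding estimator_def sum.union_disjoint[OF assms]
  by (intro sqrt_add_le_add_sqrt sum_nonneg) auto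

lemma estimator_le_max_indicator:
  assumes "finite U" "S \<subseteq> U" "\<And>T. T \<in> U \<Longrightarrow> 0 \<le> \<xi> H T"
  shows "estimator \<xi> H S \<le> sqrt (real (card S)) * max_indicator \<xi> H U"
    and "0 \<le> max_indicator \<xi> H U"
proof -
  have le: "\<xi> H T \<le> max_indicator \<xi> H U" if "T \<in> U" for T
    using assms(1) that by (auto simp: max_indicator_def)
  show nonneg: "0 \<le> max_indicator \<xi> H U"
  proof (cases "U = {}")
    case False
    then obtain T where "T \<in> U" by blast
    then show ?thesis using le[of T] assms(3)[of T] by linarith
  qed (simp add: max_indicator_def)
  have "(\<Sum>T\<in>S. (\<xi> H T)\<^sup>2) \<le> real (card S) * (max_indicator \<xi> H U)\<^sup>2"
    using le assms by (intro sum_bounded_above power_mono) auto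
  then have "estimator \<xi> H S \<le> sqrt (real (card S) * (max_indicator \<xi> H U)\<^sup>2)"
    unfolding estimator_def by (rule real_sqrt_le_mono)
  then show "estimator \<xi> H S \<le> sqrt (real (card S)) * max_indicator \<xi> H U"
    using nonneg by (simp add: real_sqrt_mult)
qed

context adaptive_meshes
begin

lemma card_large_elements:
  assumes "0 < c"
  shows "real (card {T \<in> \<T>\<^sub>l l. c \<le> vol T}) \<le> vol (closure \<Omega>) / c"
proof -
  have "real (card {T \<in> \<T>\<^sub>l l. c \<le> vol T}) * c \<le> sum vol {T \<in> \<T>\<^sub>l l. c \<le> vol T}"
    by (rule sum_bounded_below) auto
  also have "\<dots> \<le> vol (closure \<Omega>)"
    using is_meshD(3)[OF sequence_mesh] bounded_domain
    by (intro mesh_sum_vol_le[OF bounded_domain sequence_mesh]) (auto simp: lmeasurable_compact)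
  finally show ?thesis using assms by (simp add: pos_le_divide_eq)
qed

text \<open>
  Marked elements are refined, and the volumes of refined elements tend to zero.
\<close>

lemma marked_estimator_vanishes:
  assumes marked_refined: "\<And>l. M l \<inter> \<T>\<^sub>l (Suc l) = {}"
    and small: "\<And>\<epsilon>. 0 < \<epsilon> \<Longrightarrow>
      \<exists>c>0. \<forall>\<^sub>F l in sequentially. estimator \<xi> (\<T>\<^sub>l l) {T \<in> \<T>\<^sub>l l. vol T < c} \<le> \<epsilon>"
  shows "(\<lambda>l. estimator \<xi> (\<T>\<^sub>l l) (M l)) \<longlonglongrightarrow> 0"
proof (rule order_tendstoI)
  fix \<epsilon> :: real assume "0 < \<epsilon>"
  then obtain c where "0 < c"
    and c: "\<forall>\<^sub>F l in sequentially. estimator \<xi> (\<T>\<^sub>l l) {T \<in> \<T>\<^sub>l l. vol T < c} \<le> \<epsilon> / 2"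
    using small[of "\<epsilon> / 2"] by auto
  from c refined_volume_vanishes[OF \<open>0 < c\<close>]
  show "\<forall>\<^sub>F l in sequentially. estimator \<xi> (\<T>\<^sub>l l) (M l) < \<epsilon>"
  proof eventually_elim
    case (elim l)
    have "M l \<subseteq> {T \<in> \<T>\<^sub>l l. vol T < c}" using elim(2) marked[of l] marked_refined[of l] by blast
    then have "estimator \<xi> (\<T>\<^sub>l l) (M l) \<le> estimator \<xi> (\<T>\<^sub>l l) {T \<in> \<T>\<^sub>l l. vol T < c}"
      using is_meshD(1)[OF sequence_mesh, of l] by (intro estimator_mono) auto
    then show ?case using elim(1) \<open>0 < \<epsilon>\<close> by linarith
  qed
next
  fix a :: real assume "a < 0"
  then show "\<forall>\<^sub>F l in sequentially. a < estimator \<xi> (\<T>\<^sub>l l) (M l)"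
    by (intro always_eventually allI less_le_trans[OF _ estimator_nonneg])
qed

text \<open>
  As \<open>s\<close> serves the estimator on the elements of volume at least \<open>c\<close>. They are unmarked and
  their number is bounded independently of \<open>l\<close>, which yields the bound by the maximal indicator.
\<close>

lemma estimator_split_large:
  assumes c: "0 < c" "c \<le> c'" and nonneg: "\<And>T. T \<in> \<T>\<^sub>l l \<Longrightarrow> 0 \<le> \<xi> (\<T>\<^sub>l l) T"
    and small: "estimator \<xi> (\<T>\<^sub>l l) {T \<in> \<T>\<^sub>l l. vol T < c'} \<le> a"
    and M: "\<forall>T\<in>M l. vol T < c"
  shows "\<exists>s. 0 \<le> s \<and> s \<le> estimator \<xi> (\<T>\<^sub>l l) (\<T>\<^sub>l l) \<and> estimator \<xi> (\<T>\<^sub>l l) (\<T>\<^sub>l l) \<le> a + s \<and>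
           s \<le> sqrt (vol (closure \<Omega>) / c) * max_indicator \<xi> (\<T>\<^sub>l l) (\<T>\<^sub>l l - M l)"
proof -
  let ?H = "\<T>\<^sub>l l" and ?S = "{T \<in> \<T>\<^sub>l l. c \<le> vol T}" and ?R = "{T \<in> \<T>\<^sub>l l. vol T < c}"
  note fin = is_meshD(1)[OF sequence_mesh, of l]
  have "?R \<union> ?S = ?H" by auto
  then have "estimator \<xi> ?H ?H \<le> estimator \<xi> ?H ?R + estimator \<xi> ?H ?S"
    using estimator_Un_le[of ?R ?S \<xi> ?H] fin by fastforce
  moreover have "estimator \<xi> ?H ?R \<le> estimator \<xi> ?H {T \<in> ?H. vol T < c'}"
    using fin c by (intro estimator_mono) auto
  moreover have "estimator \<xi> ?H ?S \<le> estimator \<xi> ?H ?H"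
    using fin by (intro estimator_mono) auto
  moreover have "estimator \<xi> ?H ?S \<le> sqrt (vol (closure \<Omega>) / c) * max_indicator \<xi> ?H (?H - M l)"
  proof -
    have S: "?S \<subseteq> ?H - M l" using M by force
    have "estimator \<xi> ?H ?S \<le> sqrt (real (card ?S)) * max_indicator \<xi> ?H (?H - M l)"
      using fin nonneg by (intro estimator_le_max_indicator(1)[OF _ S]) auto
    also have "\<dots> \<le> sqrt (vol (closure \<Omega>) / c) * max_indicator \<xi> ?H (?H - M l)"
      using fin nonneg card_large_elements[OF c(1)]
      by (intro mult_right_mono real_sqrt_le_mono estimator_le_max_indicator(2)[OF _ order_refl]) auto
    finally show ?thesis .
  qed
  ultimately show ?thesis using small estimator_nonneg[of \<xi> ?H ?S]
    by (intro exI[of _ "estimator \<xi> ?H ?S"]) linarith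
qed

lemma product_vanishes_marking_A:
  assumes marked_refined: "\<And>l. M l \<inter> \<T>\<^sub>l (Suc l) = {}"
    and V: "marking_function_A V" and mark: "\<And>l. marking_A \<eta> \<zeta> V (\<T>\<^sub>l l) (M l)"
    and nonneg: "\<And>l T. T \<in> \<T>\<^sub>l l \<Longrightarrow> 0 \<le> \<eta> (\<T>\<^sub>l l) T" "\<And>l T. T \<in> \<T>\<^sub>l l \<Longrightarrow> 0 \<le> \<zeta> (\<T>\<^sub>l l) T"
    and bound: "\<And>l. estimator \<eta> (\<T>\<^sub>l l) (\<T>\<^sub>l l) \<le> C" "\<And>l. estimator \<zeta> (\<T>\<^sub>l l) (\<T>\<^sub>l l) \<le> C"
    and small_\<eta>: "\<And>\<epsilon>. 0 < \<epsilon> \<Longrightarrow>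
      \<exists>c>0. \<forall>\<^sub>F l in sequentially. estimator \<eta> (\<T>\<^sub>l l) {T \<in> \<T>\<^sub>l l. vol T < c} \<le> \<epsilon>"
    and small_\<zeta>: "\<And>\<epsilon>. 0 < \<epsilon> \<Longrightarrow>
      \<exists>c>0. \<forall>\<^sub>F l in sequentially. estimator \<zeta> (\<T>\<^sub>l l) {T \<in> \<T>\<^sub>l l. vol T < c} \<le> \<epsilon>"
  shows "(\<lambda>l. estimator \<eta> (\<T>\<^sub>l l) (\<T>\<^sub>l l) * estimator \<zeta> (\<T>\<^sub>l l) (\<T>\<^sub>l l)) \<longlonglongrightarrow> 0"
proof (rule order_tendstoI)
  fix b :: real assume "b < 0"
  then show "\<forall>\<^sub>F l in sequentially. b < estimator \<eta> (\<T>\<^sub>l l) (\<T>\<^sub>l l) * estimator \<zeta> (\<T>\<^sub>l l) (\<T>\<^sub>l l)"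
    by (intro always_eventually allI less_le_trans[OF _ mult_nonneg_nonneg[OF estimator_nonneg estimator_nonneg]])
next
  fix \<epsilon> :: real assume \<epsilon>: "0 < \<epsilon>"
  have C: "0 \<le> C" by (rule order_trans[OF estimator_nonneg bound(1)])
  \<comment> \<open>the two mixed terms of the product contribute at most \<open>a * C\<close> each\<close>
  define a where "a = \<epsilon> / (4 * (C + 1))"
  have a: "0 < a" "2 * (a * C) < \<epsilon> / 2"
    using \<epsilon> C by (simp_all add: a_def field_simps add_pos_nonneg)
  obtain c1 where c1: "0 < c1"
    "\<forall>\<^sub>F l in sequentially. estimator \<eta> (\<T>\<^sub>l l) {T \<in> \<T>\<^sub>l l. vol T < c1} \<le> a"
    using small_\<eta>[OF a(1)] by blast
  obtain c2 where c2: "0 < c2"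
    "\<forall>\<^sub>F l in sequentially. estimator \<zeta> (\<T>\<^sub>l l) {T \<in> \<T>\<^sub>l l. vol T < c2} \<le> a"
    using small_\<zeta>[OF a(1)] by blast
  define c where "c = min c1 c2"
  have c: "0 < c" "c \<le> c1" "c \<le> c2" using c1 c2 by (auto simp: c_def)
  define N where "N = vol (closure \<Omega>) / c"
  have N: "0 \<le> N" using c by (simp add: N_def)
  let ?x = "\<lambda>l. (estimator \<eta> (\<T>\<^sub>l l) (M l), estimator \<zeta> (\<T>\<^sub>l l) (M l))"
  have lim: "?x \<longlonglongrightarrow> (0, 0)"
    using marked_refined small_\<eta> small_\<zeta> by (intro tendsto_Pair marked_estimator_vanishes)
  have quadrant: "\<forall>\<^sub>F l in sequentially. ?x l \<in> {0..} \<times> {0..}"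
    by (simp add: estimator_nonneg)
  have "continuous (at (0, 0) within {0..} \<times> {0..}) (\<lambda>(x, y). V x y)"
    using V by (simp add: marking_function_A_def)
  from continuous_within_tendsto_compose[OF this quadrant lim]
  have "(\<lambda>l. V (estimator \<eta> (\<T>\<^sub>l l) (M l)) (estimator \<zeta> (\<T>\<^sub>l l) (M l))) \<longlonglongrightarrow> 0"
    using V by (simp add: marking_function_A_def)
  then have "\<forall>\<^sub>F l in sequentially.
      V (estimator \<eta> (\<T>\<^sub>l l) (M l)) (estimator \<zeta> (\<T>\<^sub>l l) (M l)) < \<epsilon> / (2 * (N + 1))"
    using \<epsilon> N by (intro order_tendstoD) auto
  with c1(2) c2(2) refined_volume_vanishes[OF c(1)]
  show "\<forall>\<^sub>F l in sequentially. estimator \<eta> (\<T>\<^sub>l l) (\<T>\<^sub>l l) * estimator \<zeta> (\<T>\<^sub>l l) (\<T>\<^sub>l l) < \<epsilon>"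
  proof eventually_elim
    case (elim l)
    let ?H = "\<T>\<^sub>l l" and ?m = "\<lambda>\<xi>. max_indicator \<xi> (\<T>\<^sub>l l) (\<T>\<^sub>l l - M l)"
    let ?\<eta> = "estimator \<eta> ?H ?H" and ?\<zeta> = "estimator \<zeta> ?H ?H"
    have Ml: "\<forall>T\<in>M l. vol T < c" using elim(3) marked[of l] marked_refined[of l] by blast
    obtain s where s: "0 \<le> s" "s \<le> ?\<eta>" "?\<eta> \<le> a + s" "s \<le> sqrt N * ?m \<eta>"
      using estimator_split_large[OF c(1,2) nonneg(1) elim(1) Ml] by (auto simp: N_def)
    obtain t where t: "0 \<le> t" "t \<le> ?\<zeta>" "?\<zeta> \<le> a + t" "t \<le> sqrt N * ?m \<zeta>"
      using estimator_split_large[OF c(1,3) nonneg(2) elim(2) Ml] by (auto simp: N_def)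
    have fin: "finite (?H - M l)" using is_meshD(1)[OF sequence_mesh] by blast
    have "s * t \<le> (sqrt N * ?m \<eta>) * (sqrt N * ?m \<zeta>)"
      using s t N by (intro mult_mono mult_nonneg_nonneg estimator_le_max_indicator(2)[OF fin order_refl] nonneg) auto
    also have "\<dots> = N * (?m \<eta> * ?m \<zeta>)" using N by (simp add: algebra_simps)
    also have "\<dots> \<le> N * (\<epsilon> / (2 * (N + 1)))"
      using mark[of l] elim(4) N unfolding marking_A_def by (intro mult_left_mono) auto
    also have "\<dots> \<le> \<epsilon> / 2" using N \<epsilon> by (simp add: field_simps)
    finally have st: "s * t \<le> \<epsilon> / 2" .
    have "?\<eta> * ?\<zeta> \<le> (a + s) * ?\<zeta>" using s estimator_nonneg by (intro mult_right_mono)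
    also have "\<dots> \<le> a * ?\<zeta> + s * (a + t)"
      using mult_left_mono[OF t(3) s(1)] by (simp add: algebra_simps)
    also have "\<dots> \<le> a * C + (C * a + s * t)"
    proof -
      have "a * ?\<zeta> \<le> a * C" using a(1) bound(2)[of l] by (intro mult_left_mono) auto
      moreover have "s * a \<le> C * a" using a(1) s(2) bound(1)[of l] by (intro mult_right_mono) auto
      ultimately show ?thesis by (simp add: algebra_simps)
    qed
    also have "\<dots> < \<epsilon>" using st a(2) by (simp add: algebra_simps)
    finally show ?case .
  qed
qed

end

lemma marking_B_estimator_le:
  assumes W: "marking_function_B W C\<^sub>W" and \<theta>: "0 < \<theta>" and mark: "marking_B \<eta> \<zeta> W \<theta> H M"
    and fin: "finite H" and M: "M \<subseteq> H"
    and pos: "estimator \<eta> H H * estimator \<zeta> H H \<noteq> 0"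
  shows "estimator \<eta> H H \<le> sqrt (C\<^sub>W / \<theta>) * estimator \<eta> H M \<or>
         estimator \<zeta> H H \<le> sqrt (C\<^sub>W / \<theta>) * estimator \<zeta> H M"
proof -
  let ?q = "\<lambda>\<xi>. (estimator \<xi> H M)\<^sup>2 / (estimator \<xi> H H)\<^sup>2"
  have unit: "?q \<xi> \<in> {0..1}" for \<xi>
  proof -
    have "(estimator \<xi> H M)\<^sup>2 \<le> (estimator \<xi> H H)\<^sup>2"
      using estimator_mono[OF fin M] by (intro power_mono) (auto simp: estimator_nonneg)
    then show ?thesis by (auto simp: divide_le_eq_1)
  qed
  have CW: "0 < C\<^sub>W" using W by (simp add: marking_function_B_def)
  have "\<theta> \<le> C\<^sub>W * max (?q \<eta>) (?q \<zeta>)"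
    using W mark unit[of \<eta>] unit[of \<zeta>] unfolding marking_function_B_def marking_B_def
    by (meson order_trans)
  then have "\<theta> \<le> C\<^sub>W * ?q \<eta> \<or> \<theta> \<le> C\<^sub>W * ?q \<zeta>" by (simp add: max_def split: if_splits)
  moreover have "estimator \<xi> H H \<le> sqrt (C\<^sub>W / \<theta>) * estimator \<xi> H M"
    if "\<theta> \<le> C\<^sub>W * ?q \<xi>" "estimator \<xi> H H \<noteq> 0" for \<xi>
  proof -
    have "0 < (estimator \<xi> H H)\<^sup>2" using that(2) by simp
    then have "(estimator \<xi> H H)\<^sup>2 \<le> C\<^sub>W / \<theta> * (estimator \<xi> H M)\<^sup>2"
      using that(1) \<theta> by (simp add: field_simps)
    then have "sqrt ((estimator \<xi> H H)\<^sup>2) \<le> sqrt (C\<^sub>W / \<theta> * (estimator \<xi> H M)\<^sup>2)"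
      by (rule real_sqrt_le_mono)
    then show ?thesis
      by (simp only: real_sqrt_mult real_sqrt_abs abs_of_nonneg[OF estimator_nonneg])
  qed
  ultimately show ?thesis using pos by auto
qed

lemma (in adaptive_meshes) product_vanishes_marking_B:
  assumes marked_refined: "\<And>l. M l \<inter> \<T>\<^sub>l (Suc l) = {}"
    and W: "marking_function_B W C\<^sub>W" and \<theta>: "0 < \<theta>" and mark: "\<And>l. marking_B \<eta> \<zeta> W \<theta> (\<T>\<^sub>l l) (M l)"
    and pos: "\<And>l. estimator \<eta> (\<T>\<^sub>l l) (\<T>\<^sub>l l) * estimator \<zeta> (\<T>\<^sub>l l) (\<T>\<^sub>l l) \<noteq> 0"
    and bound: "\<And>l. estimator \<eta> (\<T>\<^sub>l l) (\<T>\<^sub>l l) \<le> C" "\<And>l. estimator \<zeta> (\<T>\<^sub>l l) (\<T>\<^sub>l l) \<le> C"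
    and small_\<eta>: "\<And>\<epsilon>. 0 < \<epsilon> \<Longrightarrow>
      \<exists>c>0. \<forall>\<^sub>F l in sequentially. estimator \<eta> (\<T>\<^sub>l l) {T \<in> \<T>\<^sub>l l. vol T < c} \<le> \<epsilon>"
    and small_\<zeta>: "\<And>\<epsilon>. 0 < \<epsilon> \<Longrightarrow>
      \<exists>c>0. \<forall>\<^sub>F l in sequentially. estimator \<zeta> (\<T>\<^sub>l l) {T \<in> \<T>\<^sub>l l. vol T < c} \<le> \<epsilon>"
  shows "(\<lambda>l. estimator \<eta> (\<T>\<^sub>l l) (\<T>\<^sub>l l) * estimator \<zeta> (\<T>\<^sub>l l) (\<T>\<^sub>l l)) \<longlonglongrightarrow> 0"
proof -
  let ?\<eta> = "\<lambda>l. estimator \<eta> (\<T>\<^sub>l l)" and ?\<zeta> = "\<lambda>l. estimator \<zeta> (\<T>\<^sub>l l)"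
  define q where "q = sqrt (C\<^sub>W / \<theta>)"
  have q: "0 \<le> q" using W \<theta> by (simp add: q_def marking_function_B_def)
  have upper: "?\<eta> l (\<T>\<^sub>l l) * ?\<zeta> l (\<T>\<^sub>l l) \<le> q * C * (?\<eta> l (M l) + ?\<zeta> l (M l))" for l
  proof -
    have C: "0 \<le> C" by (rule order_trans[OF estimator_nonneg bound(1)])
    have \<eta>M: "0 \<le> q * ?\<eta> l (M l)" and \<zeta>M: "0 \<le> q * ?\<zeta> l (M l)"
      using q by (simp_all add: estimator_nonneg)
    have "?\<eta> l (\<T>\<^sub>l l) \<le> q * ?\<eta> l (M l) \<or> ?\<zeta> l (\<T>\<^sub>l l) \<le> q * ?\<zeta> l (M l)"
      unfolding q_def
      by (rule marking_B_estimator_le[OF W \<theta> mark is_meshD(1)[OF sequence_mesh] marked pos])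
    then have "?\<eta> l (\<T>\<^sub>l l) * ?\<zeta> l (\<T>\<^sub>l l) \<le> (q * ?\<eta> l (M l)) * C \<or>
        ?\<eta> l (\<T>\<^sub>l l) * ?\<zeta> l (\<T>\<^sub>l l) \<le> C * (q * ?\<zeta> l (M l))"
      using mult_mono[OF _ bound(2)[of l] \<eta>M estimator_nonneg]
        mult_mono[OF bound(1)[of l] _ C estimator_nonneg] by blast
    then show ?thesis
      using mult_nonneg_nonneg[OF \<eta>M C] mult_nonneg_nonneg[OF \<zeta>M C] by (auto simp: algebra_simps)
  qed
  have "(\<lambda>l. q * C * (?\<eta> l (M l) + ?\<zeta> l (M l))) \<longlonglongrightarrow> q * C * (0 + 0)"
    using marked_refined small_\<eta> small_\<zeta>
    by (intro tendsto_mult_left tendsto_add marked_estimator_vanishes)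
  then have lim: "(\<lambda>l. q * C * (?\<eta> l (M l) + ?\<zeta> l (M l))) \<longlonglongrightarrow> 0" by simp
  show ?thesis
    by (rule tendsto_sandwich[OF _ _ tendsto_const lim])
      (intro always_eventually allI upper mult_nonneg_nonneg estimator_nonneg)+
qed

section \<open>Convergence of the estimator product\<close>

theorem mainTheorem1:
  fixes \<Omega> :: "'a::euclidean_space set"
    and refine :: "'a mesh \<Rightarrow> 'a set set \<Rightarrow> 'a mesh"
    and H\<^sub>0 :: "'a mesh" and \<T> :: "'a mesh set"
    and X\<^sub>d :: "'a mesh \<Rightarrow> 'x::real_normed_vector set"
    and u z :: 'x and u\<^sub>d z\<^sub>d :: "'a mesh \<Rightarrow> 'x"
    and \<eta> \<zeta> :: "'a mesh \<Rightarrow> 'a set \<Rightarrow> real"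
    and G :: "'x \<Rightarrow> real" and G\<^sub>d :: "'a mesh \<Rightarrow> real"
    and V W :: "real \<Rightarrow> real \<Rightarrow> real"
    and snX :: "'a set \<Rightarrow> 'x \<Rightarrow> real" and snD :: "'a set \<Rightarrow> 'd::real_normed_vector \<Rightarrow> real"
    and D_\<eta> D_\<zeta> :: 'd
    and osc_\<eta> osc_\<zeta> :: "'a mesh \<Rightarrow> 'a set set \<Rightarrow> real"
    and w :: "real \<Rightarrow> real"
    and C_go \<theta> C\<^sub>W \<rho>_child C_patch C_size \<rho>_deff C_deff :: real
    and \<T>\<^sub>l :: "nat \<Rightarrow> 'a mesh" and M :: "nat \<Rightarrow> 'a set set"
  \<comment> \<open>general setting\<close>
  assumes "bounded \<Omega>" and "lipschitz_domain \<Omega>" and "vol \<Omega> > 0"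
    and "refinement_strategy \<Omega> refine"
    and "is_mesh \<Omega> H\<^sub>0"
    and \<T>_eq: "\<T> = refinements refine H\<^sub>0"
    and "\<And>H. H \<in> \<T> \<Longrightarrow> subspace (X\<^sub>d H)"
    and "\<And>H. H \<in> \<T> \<Longrightarrow> u\<^sub>d H \<in> X\<^sub>d H"
    and "\<And>H. H \<in> \<T> \<Longrightarrow> z\<^sub>d H \<in> X\<^sub>d H"
    and "\<And>H T. H \<in> \<T> \<Longrightarrow> T \<in> H \<Longrightarrow> 0 \<le> \<eta> H T"
    and "\<And>H T. H \<in> \<T> \<Longrightarrow> T \<in> H \<Longrightarrow> 0 \<le> \<zeta> H T"
    and "continuous_on UNIV G" and "C_go > 0"
    and "\<And>H. H \<in> \<T> \<Longrightarrow> \<bar>G u - G\<^sub>d H\<bar> \<le> C_go * (estimator \<eta> H H * estimator \<zeta> H H)"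
  \<comment> \<open>the adaptive algorithm with Marking Strategy A or Marking Strategy B\<close>
  assumes "(marking_function_A V \<and>
              adaptive_algorithm refine H\<^sub>0 \<eta> \<zeta> (marking_A \<eta> \<zeta> V) \<T>\<^sub>l M) \<or>
           (0 < \<theta> \<and> \<theta> \<le> 1 \<and> marking_function_B W C\<^sub>W \<and>
              adaptive_algorithm refine H\<^sub>0 \<eta> \<zeta> (marking_B \<eta> \<zeta> W \<theta>) \<T>\<^sub>l M)"
  \<comment> \<open>properties of the refinement strategy\<close>
  assumes "0 < \<rho>_child" and "\<rho>_child < 1" and "1 \<le> C_patch" and "1 \<le> C_size"
    and "marking_property \<T> refine"
    and "child_property \<T> refine"
    and "uniform_size_reduction \<T> refine \<rho>_child"
    and "bounded_patches \<T> C_patch"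
    and "comparable_patch_elements \<T> C_size"
  \<comment> \<open>families of seminorms\<close>
  assumes "seminorm_family \<Omega> snX" and "subadditive_family \<Omega> snX"
    and "abs_continuous_family \<Omega> snX" and "approximates_natural_norm \<Omega> snX"
    and "seminorm_family \<Omega> snD" and "subadditive_family \<Omega> snD"
    and "abs_continuous_family \<Omega> snD" and "approximates_natural_norm \<Omega> snD"
  \<comment> \<open>properties of the estimators\<close>
  assumes "0 < \<rho>_deff" and "\<rho>_deff < 1" and "1 \<le> C_deff"
    and "\<And>H T. H \<in> \<T> \<Longrightarrow> T \<in> H \<Longrightarrow> 0 \<le> osc_\<eta> H (patch H T)"
    and "\<And>H T. H \<in> \<T> \<Longrightarrow> T \<in> H \<Longrightarrow> 0 \<le> osc_\<zeta> H (patch H T)"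
    and "local_discrete_efficiency \<T> refine snX \<rho>_deff C_deff u\<^sub>d \<eta> osc_\<eta>"
    and "local_discrete_efficiency \<T> refine snX \<rho>_deff C_deff z\<^sub>d \<zeta> osc_\<zeta>"
    and "oscillation_weight w"
    and "oscillation_bounded \<T> snX snD w u\<^sub>d D_\<eta> osc_\<eta>"
    and "oscillation_bounded \<T> snX snD w z\<^sub>d D_\<zeta> osc_\<zeta>"
    and "natural_approximation \<T> refine \<rho>_deff u z u\<^sub>d z\<^sub>d"
  \<comment> \<open>a priori convergence\<close>
  assumes "\<exists>u_inf. (\<lambda>l. norm (u_inf - u\<^sub>d (\<T>\<^sub>l l))) \<longlonglongrightarrow> 0"
    and "\<exists>z_inf. (\<lambda>l. norm (z_inf - z\<^sub>d (\<T>\<^sub>l l))) \<longlonglongrightarrow> 0"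
  shows "(\<lambda>l. estimator \<eta> (\<T>\<^sub>l l) (\<T>\<^sub>l l) * estimator \<zeta> (\<T>\<^sub>l l) (\<T>\<^sub>l l)) \<longlonglongrightarrow> 0"
proof -
  let ?e = "\<lambda>\<xi> l. estimator \<xi> (\<T>\<^sub>l l) (\<T>\<^sub>l l)"
  define stop where "stop = (\<lambda>l. ?e \<eta> l * ?e \<zeta> l = 0)"
  obtain mark where algorithm: "adaptive_algorithm refine H\<^sub>0 \<eta> \<zeta> mark \<T>\<^sub>l M"
    and mark: "(marking_function_A V \<and> mark = marking_A \<eta> \<zeta> V) \<or>
      (0 < \<theta> \<and> marking_function_B W C\<^sub>W \<and> mark = marking_B \<eta> \<zeta> W \<theta>)"
    using assms(15) by blast
  have start: "\<T>\<^sub>l 0 = H\<^sub>0"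
    and run: "\<And>l. (\<And>k. k \<le> l \<Longrightarrow> \<not> stop k) \<Longrightarrow>
      M l \<subseteq> \<T>\<^sub>l l \<and> mark (\<T>\<^sub>l l) (M l) \<and> \<T>\<^sub>l (Suc l) = refine (\<T>\<^sub>l l) (M l)"
    and stopped: "\<And>l\<^sub>0 l. stop l\<^sub>0 \<Longrightarrow> (\<And>k. k < l\<^sub>0 \<Longrightarrow> \<not> stop k) \<Longrightarrow> l\<^sub>0 \<le> l \<Longrightarrow> \<T>\<^sub>l l = \<T>\<^sub>l l\<^sub>0"
    using algorithm unfolding adaptive_algorithm_def Let_def stop_def by blast+
  show ?thesis
  proof (cases "\<exists>l. stop l")
    case True
    define l\<^sub>0 where "l\<^sub>0 = (LEAST l. stop l)"
    have l\<^sub>0: "stop l\<^sub>0" "\<And>k. k < l\<^sub>0 \<Longrightarrow> \<not> stop k"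
      using True not_less_Least unfolding l\<^sub>0_def by (auto intro: LeastI)
    have "?e \<eta> l * ?e \<zeta> l = 0" if "l\<^sub>0 \<le> l" for l
      using stopped[OF l\<^sub>0 that] l\<^sub>0(1) unfolding stop_def by simp
    then show ?thesis
      by (intro tendsto_eventually) (auto simp: eventually_sequentially)
  next
    case False
    then have run: "M l \<subseteq> \<T>\<^sub>l l" "mark (\<T>\<^sub>l l) (M l)" "\<T>\<^sub>l (Suc l) = refine (\<T>\<^sub>l l) (M l)" for l
      using run by blast+
    interpret adaptive_meshes \<Omega> refine H\<^sub>0 \<T>\<^sub>l M \<rho>_child C_patch C_size
      using assms(1,4,5,21,22,16,17,23,24,18,19) start run(1,3)
      unfolding \<T>_eq by (rule adaptive_meshes.intro)
    obtain u_inf z_inf where lim: "(\<lambda>l. norm (u_inf - u\<^sub>d (\<T>\<^sub>l l))) \<longlonglongrightarrow> 0"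
      "(\<lambda>l. norm (z_inf - z\<^sub>d (\<T>\<^sub>l l))) \<longlonglongrightarrow> 0"
      using assms(44,45) by blast
    have approx: "\<exists>h\<in>sufficiently_refined refine H H \<rho>_deff. norm (u - u\<^sub>d h) \<le> \<epsilon> \<and> norm (z - z\<^sub>d h) \<le> \<epsilon>"
      if \<epsilon>: "0 < \<epsilon>" and H: "H \<in> refinements refine H\<^sub>0" for \<epsilon> H
    proof -
      obtain h where "h \<in> sufficiently_refined refine H H \<rho>_deff"
        "norm (u - u\<^sub>d h) + norm (z - z\<^sub>d h) \<le> \<epsilon>"
        using assms(43) \<epsilon> H unfolding natural_approximation_def \<T>_eq by blast
      then show ?thesis
        using norm_ge_zero[of "u - u\<^sub>d h"] norm_ge_zero[of "z - z\<^sub>d h"] by (intro bexI[of _ h]) linarith+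
    qed
    interpret primal: adaptive_estimator \<Omega> refine H\<^sub>0 \<T>\<^sub>l M \<rho>_child C_patch C_size
      snX snD u\<^sub>d \<eta> osc_\<eta> D_\<eta> w \<rho>_deff C_deff u u_inf
    proof unfold_locales
      show "\<exists>h\<in>sufficiently_refined refine H H \<rho>_deff. norm (u - u\<^sub>d h) \<le> \<epsilon>"
        if "0 < \<epsilon>" "H \<in> refinements refine H\<^sub>0" for \<epsilon> H
        using approx[OF that] by blast
    qed (use assms(25-30,32,33,35,38,40,41) lim in \<open>simp_all add: \<T>_eq\<close>)
    interpret dual: adaptive_estimator \<Omega> refine H\<^sub>0 \<T>\<^sub>l M \<rho>_child C_patch C_size
      snX snD z\<^sub>d \<zeta> osc_\<zeta> D_\<zeta> w \<rho>_deff C_deff z z_inf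
    proof unfold_locales
      show "\<exists>h\<in>sufficiently_refined refine H H \<rho>_deff. norm (z - z\<^sub>d h) \<le> \<epsilon>"
        if "0 < \<epsilon>" "H \<in> refinements refine H\<^sub>0" for \<epsilon> H
        using approx[OF that] by blast
    qed (use assms(25-30,32,33,35,39,40,42) lim in \<open>simp_all add: \<T>_eq\<close>)
    obtain C_\<eta> C_\<zeta> where "\<And>l. ?e \<eta> l \<le> C_\<eta>" "\<And>l. ?e \<zeta> l \<le> C_\<zeta>"
      using primal.estimator_bounded dual.estimator_bounded by blast
    then have bound: "?e \<eta> l \<le> max C_\<eta> C_\<zeta>" "?e \<zeta> l \<le> max C_\<eta> C_\<zeta>" for l
      by (simp_all add: max.coboundedI1 max.coboundedI2)
    have marked_refined: "M l \<inter> \<T>\<^sub>l (Suc l) = {}" for l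
      using assms(20) sequence_admissible[of l] run(1,3)[of l]
      unfolding marking_property_def \<T>_eq by auto
    have nonneg: "0 \<le> \<eta> (\<T>\<^sub>l l) T" "0 \<le> \<zeta> (\<T>\<^sub>l l) T" if "T \<in> \<T>\<^sub>l l" for l T
      using assms(10,11) sequence_admissible[of l] that by (simp_all add: \<T>_eq)
    note small = primal.small_elements_estimator dual.small_elements_estimator
    from mark show ?thesis
    proof (elim disjE conjE)
      assume "marking_function_A V" "mark = marking_A \<eta> \<zeta> V"
      then show ?thesis
        using run(2) by (intro product_vanishes_marking_A[OF marked_refined _ _ nonneg bound small]) auto
    next
      assume "0 < \<theta>" "marking_function_B W C\<^sub>W" "mark = marking_B \<eta> \<zeta> W \<theta>"
      then show ?thesis
        using run(2) False
        by (intro product_vanishes_marking_B[OF marked_refined _ _ _ _ bound small]) (auto simp: stop_def)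
    qed
  qed
qed

end
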